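(* Let $0<p<\infty$ and $w\in A_{p_0}$ with $1<p_0<\infty$. Then a subset $\mathcal{G}\subseteq L^p(w)$ is relatively compact in $L^p(w)$ if and only if the following three conditions are satisfied: (1) $\sup_{f\in\mathcal{G}}\|f\|_{L^p(w)}<\infty$; (2) $\lim_{A\to\infty}\sup_{f\in\mathcal{G}}\|f\mathbf{1}_{\{|x|>A\}}\|_{L^p(w)}=0$; (3) $$\lim_{r\to0}\sup_{f\in\mathcal{G}}\int_{\mathbb{R}^n}\bigg(\frac{1}{|B(0,r)|}\int_{B(0,r)}|f(x)-f(x+y)|^{\frac{p}{p_0}}\,dy\bigg)^{p_0}w(x)\,dx=0.$$
   Context: A weight is a measurable function $w$ on $\mathbb{R}^n$ with $0<w(x)<\infty$ a.e. $\|f\|_{L^p(w)}=(\int_{\mathbb{R}^n}|f|^pw\,dx)^{1/p}$ (a quasi-norm if $p<1$). For $1<p_0<\infty$, $w\in A_{p_0}$ means $\sup_Q\big(\frac1{|Q|}\int_Qw\,dx\big)\big(\frac1{|Q|}\int_Qw^{1-p_0'}\,dx\big)^{p_0-1}<\infty$, the supremum over all cubes $Q\subset\mathbb{R}^n$, where $\frac1{p_0}+\frac1{p_0'}=1$. $B(0,r)$ is the ball of radius $r$ centred at the origin. *)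

theory Defs
  imports "HOL-Analysis.Analysis"
begin

text \<open>
  Powers with exponent \<open>a > 0\<close> of extended nonnegative reals, with \<open>\<infinity>\<close> raised to \<open>a\<close> being \<open>\<infinity>\<close>.
\<close>

definition ennpowr :: "ennreal \<Rightarrow> real \<Rightarrow> ennreal" where
  "ennpowr x a = (if x = \<infinity> then \<infinity> else ennreal (enn2real x powr a))"

definition is_weight :: "(real ^ 'n \<Rightarrow> real) \<Rightarrow> bool" where
  "is_weight w \<longleftrightarrow> w \<in> borel_measurable lebesgue \<and> (AE x in lebesgue. 0 < w x)"

definition cubes :: "(real ^ 'n) set set" where
  "cubes = {cbox a (\<chi> i. a $ i + l) | a l. 0 < l}"

definition avg :: "(real ^ 'n) set \<Rightarrow> (real ^ 'n \<Rightarrow> ennreal) \<Rightarrow> ennreal" where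
  "avg S g = (\<integral>\<^sup>+x\<in>S. g x \<partial>lebesgue) / emeasure lebesgue S"

definition conj_exp :: "real \<Rightarrow> real" where
  "conj_exp q = q / (q - 1)"

lemma conj_exp_eq:
  assumes "1 < q"
  shows "1 / q + 1 / conj_exp q = 1"
  using assms by (simp add: conj_exp_def field_simps)

text \<open>
  For a weight both averages are nonzero, so the convention \<open>0 * \<infinity> = 0\<close> of \<^typ>\<open>ennreal\<close> is never used.
\<close>

definition A_class :: "real \<Rightarrow> (real ^ 'n \<Rightarrow> real) set" where
  "A_class q = {w. is_weight w \<and>
     (SUP Q\<in>cubes. avg Q (\<lambda>x. ennreal (w x)) *
        ennpowr (avg Q (\<lambda>x. ennreal (w x powr (1 - conj_exp q)))) (q - 1)) < \<infinity>}"

text \<open>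
  The type \<open>'k\<close> is the scalar field: up to isomorphism the finite-dimensional real normed fields are
  the real and the complex numbers.
\<close>

definition Lp_norm ::
  "real \<Rightarrow> (real ^ 'n \<Rightarrow> real) \<Rightarrow> (real ^ 'n \<Rightarrow> 'k::{real_normed_field,euclidean_space}) \<Rightarrow> ennreal" where
  "Lp_norm p w f = ennpowr (\<integral>\<^sup>+x. ennreal (norm (f x) powr p * w x) \<partial>lebesgue) (1 / p)"

definition Lp_space ::
  "real \<Rightarrow> (real ^ 'n \<Rightarrow> real) \<Rightarrow> (real ^ 'n \<Rightarrow> 'k::{real_normed_field,euclidean_space}) set" where
  "Lp_space p w = {f. f \<in> borel_measurable lebesgue \<and> Lp_norm p w f < \<infinity>}"

text \<open>
  The topology of the (quasi-)norm, on functions instead of classes modulo a.e. equality. Functions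
  that agree a.e. are topologically indistinguishable, so every open and every closed set is a union
  of classes; hence closures and compactness are the same as in the quotient.
\<close>

definition Lp_topology ::
  "real \<Rightarrow> (real ^ 'n \<Rightarrow> real) \<Rightarrow> (real ^ 'n \<Rightarrow> 'k::{real_normed_field,euclidean_space}) topology" where
  "Lp_topology p w = topology (\<lambda>U. U \<subseteq> Lp_space p w \<and>
     (\<forall>f\<in>U. \<exists>e>0. \<forall>g\<in>Lp_space p w. Lp_norm p w (\<lambda>x. g x - f x) < ennreal e \<longrightarrow> g \<in> U))"

lemma openin_Lp_topology:
  "openin (Lp_topology p w) U \<longleftrightarrow> U \<subseteq> Lp_space p w \<and>
     (\<forall>f\<in>U. \<exists>e>0. \<forall>g\<in>Lp_space p w. Lp_norm p w (\<lambda>x. g x - f x) < ennreal e \<longrightarrow> g \<in> U)"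
proof -
  let ?L = "\<lambda>U. U \<subseteq> Lp_space p w \<and>
     (\<forall>f\<in>U. \<exists>e>0. \<forall>g\<in>Lp_space p w. Lp_norm p w (\<lambda>x. g x - f x) < ennreal e \<longrightarrow> g \<in> U)"
  have "?L (S \<inter> T)" if S: "?L S" and T: "?L T" for S T
  proof (intro conjI ballI)
    show "S \<inter> T \<subseteq> Lp_space p w" using S by blast
    fix f assume f: "f \<in> S \<inter> T"
    obtain d where d: "d > 0" "\<forall>g\<in>Lp_space p w. Lp_norm p w (\<lambda>x. g x - f x) < ennreal d \<longrightarrow> g \<in> S"
      using S f by blast
    obtain e where e: "e > 0" "\<forall>g\<in>Lp_space p w. Lp_norm p w (\<lambda>x. g x - f x) < ennreal e \<longrightarrow> g \<in> T"
      using T f by blast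
    have "ennreal (min d e) \<le> ennreal d" "ennreal (min d e) \<le> ennreal e"
      by (auto intro: ennreal_leI)
    then have "\<forall>g\<in>Lp_space p w. Lp_norm p w (\<lambda>x. g x - f x) < ennreal (min d e) \<longrightarrow> g \<in> S \<inter> T"
      using d(2) e(2) order.strict_trans2 by blast
    then show "\<exists>e>0. \<forall>g\<in>Lp_space p w. Lp_norm p w (\<lambda>x. g x - f x) < ennreal e \<longrightarrow> g \<in> S \<inter> T"
      using d(1) e(1) by (intro exI[of _ "min d e"]) simp
  qed
  moreover have "?L (\<Union>K)" if K: "\<forall>S\<in>K. ?L S" for K
  proof (intro conjI ballI)
    show "\<Union>K \<subseteq> Lp_space p w" using K by blast
    fix f assume "f \<in> \<Union>K"
    then obtain S where S: "S \<in> K" "f \<in> S" by blast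
    then obtain e where "e > 0" "\<forall>g\<in>Lp_space p w. Lp_norm p w (\<lambda>x. g x - f x) < ennreal e \<longrightarrow> g \<in> S"
      using bspec[OF K S(1)] by blast
    then show "\<exists>e>0. \<forall>g\<in>Lp_space p w. Lp_norm p w (\<lambda>x. g x - f x) < ennreal e \<longrightarrow> g \<in> \<Union>K"
      using S(1) by blast
  qed
  ultimately have "istopology ?L"
    unfolding istopology_def by blast
  then show ?thesis
    unfolding Lp_topology_def by (subst topology_inverse') simp_all
qed

lemma topspace_Lp_topology: "topspace (Lp_topology p w) = Lp_space p w"
proof
  show "topspace (Lp_topology p w) \<subseteq> Lp_space p w"
    unfolding topspace_def by (auto simp: openin_Lp_topology)
  have "openin (Lp_topology p w) (Lp_space p w)"
    unfolding openin_Lp_topology by (auto intro: exI[of _ 1])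
  then show "Lp_space p w \<subseteq> topspace (Lp_topology p w)"
    by (rule openin_subset)
qed

end

theory Submission
  imports Defs
begin

text \<open>
  Put \<open>q = p\<^sub>0\<close> and \<open>s = p / q\<close>, and measure distances by the modular \<open>N(f - g)\<close>, where
  \<open>N(f) = \<integral> |f|\<^sup>p w\<close>. It satisfies \<open>N(f + g) \<le> 2\<^sup>p (N(f) + N(g))\<close> for every \<open>p > 0\<close>, and with respect to
  it \<open>L\<^sup>p(w)\<close> is complete (\<open>Lp_modular_complete\<close>). In a complete space with such a quasi-metric a set has
  compact closure if and only if it is totally bounded (\<open>compactin_closure_iff_totally_bounded\<close>). So the three
  conditions have to be compared with total boundedness. Write \<open>a\<^sub>r(x)\<close> for the mean of
  \<open>|f(x) - f(z)|\<^sup>s\<close> over \<open>z \<in> B(x, r)\<close>; the third condition says that \<open>\<integral> a\<^sub>r\<^sup>q w\<close> tends to \<open>0\<close> uniformly.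

  Necessity. Each condition holds for a single function, and it is stable under perturbations that are small
  in the modular, hence it passes from a finite net to the whole set. For the third condition stability means
  that averaging over balls of radius \<open>r\<close> is bounded on \<open>L\<^sup>q(w)\<close> uniformly in \<open>r\<close>
  (\<open>ball_average_bounded\<close>). As the radius is the same at all points, Hoelder's inequality and an exchange of
  integrals reduce the bound to the Muckenhoupt condition on one cube.
  For a single function the condition follows by approximation with continuous functions
  of bounded support (\<open>Lp_approx_continuous\<close>).

  Sufficiency. Cover a large ball by finitely many balls \<open>B\<^sub>i\<close> of radius \<open>r / 2\<close> and cut it into
  disjoint pieces \<open>E\<^sub>i \<subseteq> B\<^sub>i\<close>. For \<open>x, u \<in> E\<^sub>i\<close> averaging
  \<open>|f(x) - f(u)|\<^sup>s \<le> 2\<^sup>s (|f(x) - f(z)|\<^sup>s + |f(u) - f(z)|\<^sup>s)\<close> over \<open>z \<in> B\<^sub>i\<close> gives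
  \<open>|f(x) - f(u)|\<^sup>s \<le> c (a\<^sub>r(x) + a\<^sub>r(u))\<close>. Choosing \<open>u = u\<^sub>i\<close> such that \<open>a\<^sub>r(u)\<^sup>q\<close> is at most the
  weighted mean of \<open>a\<^sub>r\<^sup>q\<close> over \<open>E\<^sub>i\<close>, one finds that the step function with the values \<open>f(u\<^sub>i)\<close> differs from \<open>f\<close> by at
  most a constant times \<open>\<integral> a\<^sub>r\<^sup>q w\<close>, up to the tail of \<open>f\<close> (\<open>step_function_approximation\<close>). The pieces depend
  on \<open>r\<close> and on the large ball, but not on \<open>f\<close>. So up to a small error the set lies in a bounded
  part of a finite-dimensional space. Point values replace the usual averages of \<open>f\<close>, which need not exist when \<open>s < 1\<close>.
\<close>

section \<open>Powers of extended nonnegative reals\<close>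

lemma ennpowr_ennreal: "0 \<le> x \<Longrightarrow> ennpowr (ennreal x) a = ennreal (x powr a)"
  by (simp add: ennpowr_def)

lemma ennpowr_0 [simp]: "ennpowr 0 a = 0"
  by (simp add: ennpowr_def)

lemma ennpowr_top [simp]: "ennpowr top a = top"
  by (simp add: ennpowr_def)

lemma ennpowr_1 [simp]: "ennpowr x 1 = x"
  by (cases x) (auto simp: ennpowr_ennreal)

lemma ennpowr_eq_0_iff: "ennpowr x a = 0 \<longleftrightarrow> x = 0"
  by (cases x) (auto simp: ennpowr_ennreal)

lemma ennpowr_less_top_iff: "ennpowr x a < top \<longleftrightarrow> x < top"
  by (cases x) (auto simp: ennpowr_ennreal)

lemma ennpowr_mono: "0 \<le> a \<Longrightarrow> x \<le> y \<Longrightarrow> ennpowr x a \<le> ennpowr y a"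
  by (cases x; cases y) (auto simp: ennpowr_ennreal top_unique intro!: powr_mono2 ennreal_leI)

lemma ennpowr_ennpowr: "ennpowr (ennpowr x a) b = ennpowr x (a * b)"
  by (cases x) (auto simp: ennpowr_ennreal powr_powr)

lemma ennpowr_mult: "ennpowr (x * y) a = ennpowr x a * ennpowr y a"
proof (cases "x = top \<or> y = top")
  case True
  then show ?thesis
    by (cases "x = 0 \<or> y = 0") (auto simp: ennreal_top_mult ennreal_mult_top ennpowr_eq_0_iff)
next
  case False
  then show ?thesis
    by (cases x; cases y) (auto simp: ennpowr_ennreal powr_mult simp flip: ennreal_mult)
qed

lemma ennpowr_add_exp: "ennpowr x a * ennpowr x b = ennpowr x (a + b)"
  by (cases x) (auto simp: ennpowr_ennreal powr_add ennreal_mult)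

lemma ennpowr_sum_le:
  assumes a: "0 \<le> a"
  shows "ennpowr (x + y) a \<le> ennreal (2 powr a) * (ennpowr x a + ennpowr y a)"
proof -
  have "ennpowr (x + y) a \<le> ennpowr (ennreal 2 * max x y) a"
    by (intro ennpowr_mono[OF a]) (simp add: mult_2 add_mono)
  also have "\<dots> = ennreal (2 powr a) * ennpowr (max x y) a"
    by (subst ennpowr_mult) (simp only: ennpowr_ennreal)
  also have "\<dots> \<le> ennreal (2 powr a) * (ennpowr x a + ennpowr y a)"
    by (intro mult_left_mono) (auto simp: max_def add_increasing add_increasing2)
  finally show ?thesis .
qed

lemma measurable_ennpowr [measurable (raw)]:
  assumes [measurable]: "f \<in> borel_measurable M"
  shows "(\<lambda>x. ennpowr (f x) a) \<in> borel_measurable M"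
  unfolding ennpowr_def by measurable

lemma ennpowr_less_iff:
  assumes "0 < p" "0 < e"
  shows "ennpowr x (1 / p) < ennreal e \<longleftrightarrow> x < ennreal (e powr p)"
proof (cases x)
  case (real r)
  have "r powr (1 / p) < e \<longleftrightarrow> r powr (1 / p) < (e powr p) powr (1 / p)"
    using assms by (simp add: powr_powr)
  also have "\<dots> \<longleftrightarrow> r < e powr p"
    using assms real powr_mono2[of "1 / p" "e powr p" r] by (intro iffI powr_less_mono2) force+
  finally show ?thesis
    using real assms by (simp add: ennpowr_ennreal ennreal_less_iff)
qed auto

lemma norm_add_powr_le:
  fixes a b :: "'a::real_normed_vector"
  assumes "0 \<le> p"
  shows "norm (a + b) powr p \<le> 2 powr p * (norm a powr p + norm b powr p)"
proof -
  have "norm (a + b) powr p \<le> (2 * max (norm a) (norm b)) powr p"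
    using assms norm_triangle_ineq[of a b] by (intro powr_mono2) auto
  also have "\<dots> = 2 powr p * max (norm a) (norm b) powr p"
    by (simp add: powr_mult)
  also have "\<dots> \<le> 2 powr p * (norm a powr p + norm b powr p)"
    by (intro mult_left_mono) (auto simp: max_def)
  finally show ?thesis .
qed

section \<open>Compactness and total boundedness in quasi-pseudometric spaces\<close>

text \<open>
  Completeness is needed only for sequences that are Cauchy at the rate \<open>4\<^sup>-\<^sup>j\<close>: the bisection argument below
  can produce any prescribed rate, and with a fast rate pointwise limits of functions are easy to obtain.
\<close>

locale quasi_pseudometric =
  fixes X :: "'a set" and d :: "'a \<Rightarrow> 'a \<Rightarrow> ennreal" and C :: real and T :: "'a topology"
  assumes d_refl: "x \<in> X \<Longrightarrow> d x x = 0"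
    and d_sym: "d x y = d y x"
    and C_pos: "0 < C"
    and d_triangle: "x \<in> X \<Longrightarrow> y \<in> X \<Longrightarrow> z \<in> X \<Longrightarrow> d x z \<le> ennreal C * (d x y + d y z)"
    and openin_T: "openin T U \<longleftrightarrow>
      U \<subseteq> X \<and> (\<forall>x\<in>U. \<exists>e>0. \<forall>y\<in>X. d y x < ennreal e \<longrightarrow> y \<in> U)"
    and complete: "(\<And>j::nat. xs j \<in> X) \<Longrightarrow> (\<And>i j. j \<le> i \<Longrightarrow> d (xs j) (xs i) \<le> ennreal ((1/4) ^ j)) \<Longrightarrow>
      \<exists>l\<in>X. (\<lambda>j. d (xs j) l) \<longlonglongrightarrow> 0"
begin

definition totally_bounded :: "'a set \<Rightarrow> bool" where
  "totally_bounded S \<longleftrightarrow> (\<forall>e>0. \<exists>F. finite F \<and> F \<subseteq> X \<and> (\<forall>x\<in>S. \<exists>y\<in>F. d x y < ennreal e))"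

lemma topspace_T: "topspace T = X"
proof
  show "topspace T \<subseteq> X"
    unfolding topspace_def by (auto simp: openin_T)
  have "openin T X"
    unfolding openin_T by (auto intro: exI[of _ 1])
  then show "X \<subseteq> topspace T"
    by (rule openin_subset)
qed

lemma d_triangle_less:
  assumes "x \<in> X" "y \<in> X" "z \<in> X" "d x y < ennreal (e / (2 * C))" "d y z < ennreal (e / (2 * C))"
  shows "d x z < ennreal e"
proof -
  have e: "0 < e"
    using assms(4) C_pos by (metis divide_nonpos_pos ennreal_neg less_le_not_le linorder_not_less
        mult_2 not_less_zero add_pos_pos)
  have "d x z \<le> ennreal C * (d x y + d y z)"
    using assms by (intro d_triangle)
  also have "\<dots> < ennreal C * (ennreal (e / (2 * C)) + ennreal (e / (2 * C)))"
    using assms C_pos by (intro ennreal_mult_strict_left_mono add_strict_mono) auto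
  also have "\<dots> = ennreal e"
    using e C_pos by (simp flip: ennreal_plus ennreal_mult)
  finally show ?thesis .
qed

text \<open>
  With a quasi-triangle inequality balls need not be open. The points that have some ball around
  them inside a given ball do form an open set, and this set contains the centre.
\<close>

lemma neighbourhood_in_ball:
  assumes x: "x \<in> X" and e: "0 < e"
  obtains U where "openin T U" "x \<in> U" "\<And>y. y \<in> U \<Longrightarrow> d y x < ennreal e"
proof
  define U where "U = {y \<in> X. \<exists>r>0. \<forall>z\<in>X. d z y < ennreal r \<longrightarrow> d z x < ennreal e}"
  show "openin T U"
    unfolding openin_T
  proof (intro conjI ballI)
    show "U \<subseteq> X" by (auto simp: U_def)
    fix y assume "y \<in> U"
    then obtain r where r: "y \<in> X" "0 < r" "\<And>z. z \<in> X \<Longrightarrow> d z y < ennreal r \<Longrightarrow> d z x < ennreal e"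
      by (auto simp: U_def)
    show "\<exists>s>0. \<forall>z\<in>X. d z y < ennreal s \<longrightarrow> z \<in> U"
    proof (intro exI conjI ballI impI)
      show pos: "0 < r / (2 * C)" using r C_pos by simp
      fix z assume z: "z \<in> X" "d z y < ennreal (r / (2 * C))"
      have "d v x < ennreal e" if "v \<in> X" "d v z < ennreal (r / (2 * C))" for v
        using that z r by (intro r(3) d_triangle_less[of v z y])
      then show "z \<in> U"
        using z pos unfolding U_def by blast
    qed
  qed
  show "x \<in> U" using x e by (auto simp: U_def)
  show "d y x < ennreal e" if "y \<in> U" for y
    using that d_refl unfolding U_def by fastforce
qed

lemma totally_bounded_if_compact_closure:
  assumes S: "S \<subseteq> X" and comp: "compactin T (T closure_of S)"
  shows "totally_bounded S"
  unfolding totally_bounded_def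
proof (intro allI impI)
  fix e :: real assume e: "0 < e"
  define N where "N x = (SOME U. openin T U \<and> x \<in> U \<and> (\<forall>y\<in>U. d y x < ennreal e))" for x
  have N: "openin T (N x) \<and> x \<in> N x \<and> (\<forall>y\<in>N x. d y x < ennreal e)" if "x \<in> X" for x
    unfolding N_def by (rule someI_ex) (meson neighbourhood_in_ball[OF that e])
  let ?K = "T closure_of S"
  have K: "?K \<subseteq> X" using closure_of_subset_topspace[of T S] topspace_T by simp
  obtain F where F: "finite F" "F \<subseteq> N ` ?K" "?K \<subseteq> \<Union>F"
    using comp N K unfolding compactin_def
    by (smt (verit, ccfv_threshold) UN_I image_iff subset_eq)
  then obtain F' where F': "finite F'" "F' \<subseteq> ?K" "F = N ` F'"
    by (meson finite_subset_image)
  have "S \<subseteq> ?K" using S by (intro closure_of_subset) (simp add: topspace_T)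
  then have "\<forall>x\<in>S. \<exists>y\<in>F'. d x y < ennreal e"
    using F F' N K by (smt (verit, best) UnionE imageE subset_iff)
  then show "\<exists>F. finite F \<and> F \<subseteq> X \<and> (\<forall>x\<in>S. \<exists>y\<in>F. d x y < ennreal e)"
    using F' K by blast
qed

lemma totally_bounded_closure:
  assumes S: "S \<subseteq> X" and tb: "totally_bounded S"
  shows "totally_bounded (T closure_of S)"
  unfolding totally_bounded_def
proof (intro allI impI)
  fix e :: real assume e: "0 < e"
  then have e': "0 < e / (2 * C)" using C_pos by simp
  then obtain F where F: "finite F" "F \<subseteq> X" "\<And>x. x \<in> S \<Longrightarrow> \<exists>y\<in>F. d x y < ennreal (e / (2 * C))"
    using tb unfolding totally_bounded_def by meson
  have "\<exists>y\<in>F. d x y < ennreal e" if x: "x \<in> T closure_of S" for x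
  proof -
    have xX: "x \<in> X" using x closure_of_subset_topspace[of T S] topspace_T by blast
    obtain U where U: "openin T U" "x \<in> U" "\<And>y. y \<in> U \<Longrightarrow> d y x < ennreal (e / (2 * C))"
      using neighbourhood_in_ball[OF xX e'] by blast
    then obtain z where z: "z \<in> S" "z \<in> U"
      using x unfolding in_closure_of by blast
    obtain y where "y \<in> F" "d z y < ennreal (e / (2 * C))"
      using F(3)[OF z(1)] by blast
    then show ?thesis
      using U(3)[OF z(2)] xX z S F(2) by (intro bexI[of _ y] d_triangle_less[of x z y]) (auto simp: d_sym)
  qed
  then show "\<exists>F. finite F \<and> F \<subseteq> X \<and> (\<forall>x\<in>T closure_of S. \<exists>y\<in>F. d x y < ennreal e)"
    using F by blast
qed

text \<open>
  The bisection argument: if no finite subfamily covers \<open>K\<close>, then there are decreasing pieces of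
  \<open>K\<close> of diameter at most \<open>4\<^sup>-\<^sup>j\<close> that no finite subfamily covers. Points chosen in these pieces
  converge to a point of \<open>K\<close>, and the member of the cover around this point contains one of the pieces.
\<close>

lemma compactin_if_totally_bounded:
  assumes K: "closedin T K" and tb: "totally_bounded K"
  shows "compactin T K"
  unfolding compactin_def
proof (intro conjI allI impI)
  show "K \<subseteq> topspace T" using K by (rule closedin_subset)
  then have KX: "K \<subseteq> X" by (simp add: topspace_T)
  fix \<U> assume \<U>: "Ball \<U> (openin T) \<and> K \<subseteq> \<Union>\<U>"
  define bad where "bad A \<longleftrightarrow> A \<subseteq> K \<and> \<not> (\<exists>\<F>. finite \<F> \<and> \<F> \<subseteq> \<U> \<and> A \<subseteq> \<Union>\<F>)" for A
  define small where "small j A \<longleftrightarrow> (\<forall>x\<in>A. \<forall>y\<in>A. d x y \<le> ennreal ((1/4) ^ j))" for j :: nat and A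
  \<comment> \<open>A bad set is covered by finitely many balls of small radius, and one of them cuts out a bad piece.\<close>
  have split: "\<exists>B. bad B \<and> B \<subseteq> A \<and> small j B" if A: "bad A" for A j
  proof -
    have AK: "A \<subseteq> K" using A by (simp add: bad_def)
    define e where "e = (1/4) ^ j / (2 * C)"
    have "0 < e" using C_pos by (simp add: e_def)
    then obtain F where F: "finite F" "F \<subseteq> X" "\<And>x. x \<in> K \<Longrightarrow> \<exists>y\<in>F. d x y < ennreal e"
      using tb unfolding totally_bounded_def by meson
    have "\<exists>y\<in>F. bad {x \<in> A. d x y < ennreal e}"
    proof (rule ccontr)
      assume "\<not> ?thesis"
      moreover have "{x \<in> A. d x y < ennreal e} \<subseteq> K" for y
        using AK by blast
      ultimately have "\<forall>y\<in>F. \<exists>\<F>. finite \<F> \<and> \<F> \<subseteq> \<U> \<and> {x \<in> A. d x y < ennreal e} \<subseteq> \<Union>\<F>"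
        unfolding bad_def by meson
      from bchoice[OF this] obtain \<F>
        where \<F>: "\<forall>y\<in>F. finite (\<F> y) \<and> \<F> y \<subseteq> \<U> \<and> {x \<in> A. d x y < ennreal e} \<subseteq> \<Union>(\<F> y)" ..
      have "A \<subseteq> \<Union>(\<Union>y\<in>F. \<F> y)"
      proof
        fix x assume x: "x \<in> A"
        then obtain y where y: "y \<in> F" "d x y < ennreal e"
          using F(3)[OF subsetD[OF AK x]] by auto
        then have "x \<in> \<Union>(\<F> y)" using bspec[OF \<F> y(1)] x by auto
        then show "x \<in> \<Union>(\<Union>y\<in>F. \<F> y)" using y(1) by auto
      qed
      moreover have "finite (\<Union>y\<in>F. \<F> y)" "(\<Union>y\<in>F. \<F> y) \<subseteq> \<U>" using \<F> F(1) by auto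
      ultimately show False using A unfolding bad_def by meson
    qed
    then obtain y where y: "y \<in> F" "bad {x \<in> A. d x y < ennreal e}" by blast
    have "small j {x \<in> A. d x y < ennreal e}"
      unfolding small_def
    proof (intro ballI)
      fix u v assume "u \<in> {x \<in> A. d x y < ennreal e}" "v \<in> {x \<in> A. d x y < ennreal e}"
      then have "d u v < ennreal ((1/4) ^ j)"
        using AK KX F(2) y(1) unfolding e_def by (intro d_triangle_less[of u y v]) (auto simp: d_sym)
      then show "d u v \<le> ennreal ((1/4) ^ j)" by simp
    qed
    then show ?thesis using y by blast
  qed
  show "\<exists>\<F>. finite \<F> \<and> \<F> \<subseteq> \<U> \<and> K \<subseteq> \<Union>\<F>"
  proof (rule ccontr)
    assume "\<not> ?thesis"
    then have "bad K" by (simp add: bad_def)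
    then have "\<exists>A. bad A \<and> small 0 A" using split[of K 0] by blast
    moreover have "\<exists>B. (bad B \<and> small (Suc j) B) \<and> B \<subseteq> A" if "bad A \<and> small j A" for A j
      using split[of A "Suc j"] that by blast
    ultimately obtain A where A: "\<And>j. bad (A j) \<and> small j (A j)" "\<And>j. A (Suc j) \<subseteq> A j"
      using dependent_nat_choice[of "\<lambda>j A. bad A \<and> small j A" "\<lambda>j A B. B \<subseteq> A"] by metis
    have mono: "A i \<subseteq> A j" if "j \<le> i" for i j
      using lift_Suc_antimono_le[of A j i] A(2) that by blast
    have "A j \<noteq> {}" for j using A(1)[of j] unfolding bad_def by (metis empty_subsetI finite.emptyI)
    then have "\<forall>j. \<exists>y. y \<in> A j" by blast
    then obtain x where x: "\<And>j. x j \<in> A j" by metis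
    have AX: "A j \<subseteq> X" for j using A(1)[of j] KX unfolding bad_def by blast
    then have xX: "x j \<in> X" for j using x by blast
    have "d (x j) (x i) \<le> ennreal ((1/4) ^ j)" if "j \<le> i" for i j
      using A(1)[of j] x[of j] x[of i] mono[OF that] unfolding small_def by blast
    then obtain l where l: "l \<in> X" "(\<lambda>j. d (x j) l) \<longlonglongrightarrow> 0"
      using complete[of x] xX by blast
    have near: "eventually (\<lambda>j. d (x j) l < ennreal r) sequentially" if "0 < r" for r
      using order_tendstoD(2)[OF l(2), of "ennreal r"] that by simp
    have "l \<in> K"
    proof (rule ccontr)
      assume "l \<notin> K"
      then have "l \<in> X - K" "openin T (X - K)" using l K by (auto simp: closedin_def topspace_T)
      then obtain r where r: "0 < r" "\<And>y. y \<in> X \<Longrightarrow> d y l < ennreal r \<Longrightarrow> y \<in> X - K"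
        unfolding openin_T by meson
      then obtain j where "d (x j) l < ennreal r"
        using near[OF r(1)] by (auto dest: eventually_happens'[OF sequentially_bot])
      then have "x j \<notin> K" using r(2) xX by blast
      then show False using x[of j] A(1)[of j] unfolding bad_def by blast
    qed
    then obtain U where U: "U \<in> \<U>" "l \<in> U" using \<U> by blast
    then have "openin T U" using \<U> by blast
    then obtain r where r: "0 < r" "\<And>y. y \<in> X \<Longrightarrow> d y l < ennreal r \<Longrightarrow> y \<in> U"
      using U unfolding openin_T by meson
    define r' where "r' = r / (2 * C)"
    have r': "0 < r'" using r C_pos by (simp add: r'_def)
    have "eventually (\<lambda>j. (1/4::real) ^ j < r') sequentially"
      using order_tendstoD(2)[OF LIMSEQ_realpow_zero[of "1/4::real"] r'] by simp
    with near[OF r'] have "eventually (\<lambda>j. (1/4) ^ j < r' \<and> d (x j) l < ennreal r') sequentially"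
      by eventually_elim simp
    then obtain j where j: "(1/4) ^ j < r'" "d (x j) l < ennreal r'"
      by (auto dest: eventually_happens'[OF sequentially_bot])
    have "A j \<subseteq> U"
    proof
      fix y assume y: "y \<in> A j"
      have "d y (x j) \<le> ennreal ((1/4) ^ j)" using y x A(1)[of j] unfolding small_def by blast
      also have "\<dots> < ennreal r'" using j by (intro ennreal_lessI) (auto simp: r')
      finally have "d y l < ennreal r"
        using y AX xX l(1) j(2) unfolding r'_def by (intro d_triangle_less[of y "x j" l]) auto
      then show "y \<in> U" using r(2) y AX by blast
    qed
    then have "finite {U} \<and> {U} \<subseteq> \<U> \<and> A j \<subseteq> \<Union>{U}" using U(1) by simp
    then have "\<exists>\<F>. finite \<F> \<and> \<F> \<subseteq> \<U> \<and> A j \<subseteq> \<Union>\<F>" by (rule exI)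
    then show False using A(1)[of j] by (simp only: bad_def) simp
  qed
qed

theorem compactin_closure_iff_totally_bounded:
  assumes "S \<subseteq> X"
  shows "compactin T (T closure_of S) \<longleftrightarrow> totally_bounded S"
  using assms totally_bounded_if_compact_closure totally_bounded_closure
    compactin_if_totally_bounded closedin_closure_of by blast

end

section \<open>The modular of a weighted Lebesgue space\<close>

text \<open>
  The \<open>p\<close>-th power of the quasi-norm. Unlike the quasi-norm itself it allows the cases \<open>p < 1\<close> and \<open>p \<ge> 1\<close>
  to be treated alike.
\<close>

definition Lp_modular ::
  "real \<Rightarrow> (real ^ 'n \<Rightarrow> real) \<Rightarrow> (real ^ 'n \<Rightarrow> 'k::{real_normed_field,euclidean_space}) \<Rightarrow> ennreal" where
  "Lp_modular p w f = (\<integral>\<^sup>+x. ennreal (norm (f x) powr p) * ennreal (w x) \<partial>lebesgue)"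

lemma Lp_norm_eq_modular: "Lp_norm p w f = ennpowr (Lp_modular p w f) (1 / p)"
  by (simp add: Lp_norm_def Lp_modular_def ennreal_mult')

lemma Lp_norm_less_iff:
  "0 < p \<Longrightarrow> 0 < e \<Longrightarrow> Lp_norm p w f < ennreal e \<longleftrightarrow> Lp_modular p w f < ennreal (e powr p)"
  by (simp add: Lp_norm_eq_modular ennpowr_less_iff)

lemma Lp_space_iff: "f \<in> Lp_space p w \<longleftrightarrow> f \<in> borel_measurable lebesgue \<and> Lp_modular p w f < top"
  by (simp add: Lp_space_def Lp_norm_eq_modular ennpowr_less_top_iff)

lemma Lp_space_measurable: "f \<in> Lp_space p w \<Longrightarrow> f \<in> borel_measurable lebesgue"
  by (simp add: Lp_space_iff)

lemma Lp_modular_minus_commute: "Lp_modular p w (\<lambda>x. f x - g x) = Lp_modular p w (\<lambda>x. g x - f x)"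
  by (simp add: Lp_modular_def norm_minus_commute)

lemma Lp_modular_add_le:
  assumes "0 \<le> p" and [measurable]: "w \<in> borel_measurable lebesgue"
    "f \<in> borel_measurable lebesgue" "g \<in> borel_measurable lebesgue"
  shows "Lp_modular p w (\<lambda>x. f x + g x) \<le> ennreal (2 powr p) * (Lp_modular p w f + Lp_modular p w g)"
proof -
  have "Lp_modular p w (\<lambda>x. f x + g x) \<le>
      (\<integral>\<^sup>+x. ennreal (2 powr p) * (ennreal (norm (f x) powr p) * ennreal (w x) +
        ennreal (norm (g x) powr p) * ennreal (w x)) \<partial>lebesgue)"
    unfolding Lp_modular_def
  proof (rule nn_integral_mono)
    fix x
    have "ennreal (norm (f x + g x) powr p) \<le>
        ennreal (2 powr p) * (ennreal (norm (f x) powr p) + ennreal (norm (g x) powr p))"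
      using norm_add_powr_le[OF assms(1), of "f x" "g x"]
      by (simp add: ennreal_leI flip: ennreal_plus ennreal_mult)
    from mult_right_mono[OF this, of "ennreal (w x)"]
    show "ennreal (norm (f x + g x) powr p) * ennreal (w x) \<le>
      ennreal (2 powr p) * (ennreal (norm (f x) powr p) * ennreal (w x) +
        ennreal (norm (g x) powr p) * ennreal (w x))"
      by (simp add: algebra_simps)
  qed
  also have "\<dots> = ennreal (2 powr p) * (Lp_modular p w f + Lp_modular p w g)"
    unfolding Lp_modular_def by (subst nn_integral_cmult) (auto simp: nn_integral_add)
  finally show ?thesis .
qed

lemma Lp_modular_le_diff:
  assumes "0 \<le> p" and [measurable]: "w \<in> borel_measurable lebesgue"
    "f \<in> borel_measurable lebesgue" "g \<in> borel_measurable lebesgue"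
  shows "Lp_modular p w f \<le> ennreal (2 powr p) * (Lp_modular p w (\<lambda>x. f x - g x) + Lp_modular p w g)"
  using Lp_modular_add_le[OF assms(1,2), of "\<lambda>x. f x - g x" g] by simp

lemma Lp_modular_triangle:
  assumes "0 \<le> p" and [measurable]: "w \<in> borel_measurable lebesgue"
    "f \<in> borel_measurable lebesgue" "g \<in> borel_measurable lebesgue" "h \<in> borel_measurable lebesgue"
  shows "Lp_modular p w (\<lambda>x. f x - h x) \<le>
    ennreal (2 powr p) * (Lp_modular p w (\<lambda>x. f x - g x) + Lp_modular p w (\<lambda>x. g x - h x))"
  using Lp_modular_add_le[OF assms(1,2), of "\<lambda>x. f x - g x" "\<lambda>x. g x - h x"] by simp

text \<open>
  The increments \<open>f\<^sub>j\<^sub>+\<^sub>1 - f\<^sub>j\<close> have modular at most \<open>4\<^sup>-\<^sup>j\<close>, so \<open>\<Sum>\<^sub>j 2\<^sup>j |f\<^sub>j\<^sub>+\<^sub>1 - f\<^sub>j|\<^sup>p\<close> is integrable against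
  the weight. Almost everywhere, therefore, the increments are bounded by a multiple of \<open>(2\<^sup>-\<^sup>1\<^sup>/\<^sup>p)\<^sup>j\<close>, which
  is summable for every \<open>p > 0\<close>, and the sequence converges pointwise. Fatou's lemma turns this into
  convergence in the modular.
\<close>

lemma Lp_modular_complete:
  fixes f :: "nat \<Rightarrow> real ^ 'n \<Rightarrow> 'k::{real_normed_field,euclidean_space}"
  assumes p: "0 < p" and w: "is_weight w" and f: "\<And>j. f j \<in> Lp_space p w"
    and cauchy: "\<And>i j. j \<le> i \<Longrightarrow> Lp_modular p w (\<lambda>x. f j x - f i x) \<le> ennreal ((1/4) ^ j)"
  shows "\<exists>l\<in>Lp_space p w. (\<lambda>j. Lp_modular p w (\<lambda>x. f j x - l x)) \<longlonglongrightarrow> 0"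
proof -
  have [measurable]: "w \<in> borel_measurable lebesgue" "\<And>j. f j \<in> borel_measurable lebesgue"
    using w f by (auto simp: is_weight_def Lp_space_iff)
  let ?D = "\<lambda>j x. ennreal (2 ^ j) * (ennreal (norm (f j x - f (Suc j) x) powr p) * ennreal (w x))"
  have "(\<integral>\<^sup>+x. (\<Sum>j. ?D j x) \<partial>lebesgue) = (\<Sum>j. ennreal (2 ^ j) * Lp_modular p w (\<lambda>x. f j x - f (Suc j) x))"
    unfolding Lp_modular_def by (subst nn_integral_suminf) (auto simp: nn_integral_cmult)
  also have "\<dots> \<le> (\<Sum>j. ennreal ((1/2) ^ j))"
  proof (intro suminf_le summableI)
    fix j
    have "ennreal (2 ^ j) * Lp_modular p w (\<lambda>x. f j x - f (Suc j) x) \<le> ennreal (2 ^ j) * ennreal ((1/4) ^ j)"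
      by (intro mult_left_mono cauchy) auto
    also have "\<dots> = ennreal ((1/2) ^ j)"
      by (simp flip: ennreal_mult power_mult_distrib)
    finally show "ennreal (2 ^ j) * Lp_modular p w (\<lambda>x. f j x - f (Suc j) x) \<le> ennreal ((1/2) ^ j)" .
  qed
  also have "\<dots> < top"
    by (subst suminf_ennreal2) (auto intro!: summable_geometric)
  finally have "AE x in lebesgue. (\<Sum>j. ?D j x) \<noteq> top"
    by (intro nn_integral_PInf_AE[unfolded infinity_ennreal_def]) auto
  moreover have "AE x in lebesgue. 0 < w x"
    using w by (simp add: is_weight_def)
  ultimately have conv: "AE x in lebesgue. convergent (\<lambda>j. f j x)"
  proof eventually_elim
    fix x assume fin: "(\<Sum>j. ?D j x) \<noteq> top" and wx: "0 < w x"
    define B where "B = enn2real (\<Sum>j. ?D j x)"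
    have B: "0 \<le> B" by (simp add: B_def)
    define c where "c = (1/2::real) powr (1/p)"
    have c: "0 < c" "c < 1" using p powr_less_mono2[of "1/p" "1/2" 1] by (auto simp: c_def)
    have bound: "norm (f (Suc j) x - f j x) \<le> (B / w x) powr (1/p) * c ^ j" for j
    proof -
      have "?D j x \<le> (\<Sum>j. ?D j x)"
        using sum_le_suminf[of "\<lambda>j. ?D j x" "{j}"] by (simp add: summableI)
      also have "\<dots> = ennreal B" using fin by (simp add: B_def less_top)
      finally have "2 ^ j * (norm (f j x - f (Suc j) x) powr p * w x) \<le> B"
        using wx B by (simp flip: ennreal_mult)
      then have "norm (f j x - f (Suc j) x) powr p \<le> (B / w x) * (1/2) ^ j"
        using wx by (simp add: field_simps)
      then have "(norm (f j x - f (Suc j) x) powr p) powr (1/p) \<le> ((B / w x) * (1/2) ^ j) powr (1/p)"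
        using p by (intro powr_mono2) auto
      also have "\<dots> = (B / w x) powr (1/p) * c ^ j"
        using wx B by (subst powr_mult)
          (auto simp: c_def powr_powr mult.commute simp flip: powr_realpow)
      finally show ?thesis using p by (simp add: powr_powr norm_minus_commute)
    qed
    have "summable (\<lambda>j. f (Suc j) x - f j x)"
      by (rule summable_comparison_test'[where N = 0 and g = "\<lambda>j. (B / w x) powr (1/p) * c ^ j"])
        (use c bound in \<open>auto intro!: summable_mult summable_geometric\<close>)
    then have "convergent (\<lambda>n. \<Sum>j<n. f (Suc j) x - f j x)"
      by (simp add: summable_iff_convergent)
    then have "convergent (\<lambda>n. f n x - f 0 x)"
      by (simp only: sum_lessThan_telescope[of "\<lambda>j. f j x"])
    from convergent_add[OF this convergent_const[of "f 0 x"]] show "convergent (\<lambda>j. f j x)" by simp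
  qed
  define l where "l x = lim (\<lambda>j. f j x)" for x
  have [measurable]: "l \<in> borel_measurable lebesgue"
    unfolding l_def by measurable
  have limit: "Lp_modular p w (\<lambda>x. f j x - l x) \<le> ennreal ((1/4) ^ j)" for j
  proof -
    have "Lp_modular p w (\<lambda>x. f j x - l x) =
        (\<integral>\<^sup>+x. liminf (\<lambda>i. ennreal (norm (f j x - f i x) powr p) * ennreal (w x)) \<partial>lebesgue)"
      unfolding Lp_modular_def
    proof (rule nn_integral_cong_AE)
      show "AE x in lebesgue. ennreal (norm (f j x - l x) powr p) * ennreal (w x) =
          liminf (\<lambda>i. ennreal (norm (f j x - f i x) powr p) * ennreal (w x))"
        using conv
      proof eventually_elim
        fix x assume "convergent (\<lambda>j. f j x)"
        then have "(\<lambda>i. f i x) \<longlonglongrightarrow> l x" by (simp add: l_def convergent_LIMSEQ_iff)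
        then have "(\<lambda>i. norm (f j x - f i x) powr p * w x) \<longlonglongrightarrow> norm (f j x - l x) powr p * w x"
          using p by (intro tendsto_intros tendsto_powr2) auto
        then have "(\<lambda>i. ennreal (norm (f j x - f i x) powr p * w x)) \<longlonglongrightarrow> ennreal (norm (f j x - l x) powr p * w x)"
          by (rule tendsto_ennrealI)
        then show "ennreal (norm (f j x - l x) powr p) * ennreal (w x) =
            liminf (\<lambda>i. ennreal (norm (f j x - f i x) powr p) * ennreal (w x))"
          by (simp add: lim_imp_Liminf ennreal_mult')
      qed
    qed
    also have "\<dots> \<le> liminf (\<lambda>i. Lp_modular p w (\<lambda>x. f j x - f i x))"
      unfolding Lp_modular_def by (rule nn_integral_liminf) auto
    also have "\<dots> \<le> liminf (\<lambda>i. ennreal ((1/4) ^ j))"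
      by (intro Liminf_mono eventually_sequentiallyI[of j] cauchy)
    finally show ?thesis by (simp add: Liminf_const)
  qed
  have "Lp_modular p w l \<le> ennreal (2 powr p) * (Lp_modular p w (\<lambda>x. l x - f 0 x) + Lp_modular p w (f 0))"
    using p by (intro Lp_modular_le_diff) auto
  also have "\<dots> < top"
    using f[of 0] limit[of 0]
    by (auto simp: Lp_space_iff Lp_modular_minus_commute[of p w l] ennreal_mult_less_top intro: le_less_trans)
  finally have "l \<in> Lp_space p w" by (simp add: Lp_space_iff)
  moreover have "(\<lambda>j. Lp_modular p w (\<lambda>x. f j x - l x)) \<longlonglongrightarrow> 0"
  proof (rule tendsto_sandwich[OF _ _ tendsto_const])
    have "(\<lambda>j. ennreal ((1/4) ^ j)) \<longlonglongrightarrow> ennreal 0"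
      by (intro tendsto_ennrealI LIMSEQ_realpow_zero) auto
    then show "(\<lambda>j. ennreal ((1/4) ^ j)) \<longlonglongrightarrow> 0" by simp
  qed (use limit in auto)
  ultimately show ?thesis by blast
qed

lemma quasi_pseudometric_Lp:
  fixes w :: "real ^ 'n \<Rightarrow> real"
  assumes p: "0 < p" and w: "is_weight w"
  shows "quasi_pseudometric (Lp_space p w) 
    (\<lambda>f g :: real ^ 'n \<Rightarrow> 'k::{real_normed_field,euclidean_space}. Lp_modular p w (\<lambda>x. f x - g x))
    (2 powr p) (Lp_topology p w)"
proof
  have wm: "w \<in> borel_measurable lebesgue" using w by (simp add: is_weight_def)
  fix f g h :: "real ^ 'n \<Rightarrow> 'k"
  show "Lp_modular p w (\<lambda>x. f x - f x) = 0" by (simp add: Lp_modular_def)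
  show "Lp_modular p w (\<lambda>x. f x - g x) = Lp_modular p w (\<lambda>x. g x - f x)"
    by (rule Lp_modular_minus_commute)
  show "Lp_modular p w (\<lambda>x. f x - h x) \<le>
      ennreal (2 powr p) * (Lp_modular p w (\<lambda>x. f x - g x) + Lp_modular p w (\<lambda>x. g x - h x))"
    if "f \<in> Lp_space p w" "g \<in> Lp_space p w" "h \<in> Lp_space p w"
    using that p wm by (intro Lp_modular_triangle) (auto simp: Lp_space_iff)
next
  fix U :: "(real ^ 'n \<Rightarrow> 'k) set"
  have "(\<exists>e>0. \<forall>g\<in>Lp_space p w. Lp_norm p w (\<lambda>x. g x - f x) < ennreal e \<longrightarrow> g \<in> U) \<longleftrightarrow>
      (\<exists>e>0. \<forall>g\<in>Lp_space p w. Lp_modular p w (\<lambda>x. g x - f x) < ennreal e \<longrightarrow> g \<in> U)"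
    (is "?L \<longleftrightarrow> ?R") for f
  proof
    assume ?L
    then obtain e where "0 < e" "\<forall>g\<in>Lp_space p w. Lp_norm p w (\<lambda>x. g x - f x) < ennreal e \<longrightarrow> g \<in> U"
      by blast
    then show ?R using p by (intro exI[of _ "e powr p"]) (simp add: Lp_norm_less_iff)
  next
    assume ?R
    then obtain e where "0 < e" "\<forall>g\<in>Lp_space p w. Lp_modular p w (\<lambda>x. g x - f x) < ennreal e \<longrightarrow> g \<in> U"
      by blast
    then show ?L using p by (intro exI[of _ "e powr (1 / p)"]) (simp add: Lp_norm_less_iff powr_powr)
  qed
  then show "openin (Lp_topology p w) U \<longleftrightarrow> U \<subseteq> Lp_space p w \<and>
      (\<forall>f\<in>U. \<exists>e>0. \<forall>g\<in>Lp_space p w. Lp_modular p w (\<lambda>x. g x - f x) < ennreal e \<longrightarrow> g \<in> U)"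
    by (simp add: openin_Lp_topology)
next
  fix f :: "nat \<Rightarrow> real ^ 'n \<Rightarrow> 'k"
  assume "\<And>j. f j \<in> Lp_space p w"
    "\<And>i j. j \<le> i \<Longrightarrow> Lp_modular p w (\<lambda>x. f j x - f i x) \<le> ennreal ((1 / 4) ^ j)"
  then show "\<exists>l\<in>Lp_space p w. (\<lambda>j. Lp_modular p w (\<lambda>x. f j x - l x)) \<longlonglongrightarrow> 0"
    by (intro Lp_modular_complete p w)
qed simp

section \<open>Averages over balls and Muckenhoupt weights\<close>

lemma sigma_finite_lebesgue: "sigma_finite_measure (lebesgue :: 'a::euclidean_space measure)"
proof
  obtain A :: "'a set set" where A: "countable A" "A \<subseteq> sets lborel" "\<Union>A = space lborel"
    "\<forall>a\<in>A. emeasure lborel a \<noteq> \<infinity>"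
    using lborel.sigma_finite_countable by blast
  show "\<exists>A::'a set set. countable A \<and> A \<subseteq> sets lebesgue \<and> \<Union>A = space lebesgue \<and>
      (\<forall>a\<in>A. emeasure lebesgue a \<noteq> \<infinity>)"
    using A by (intro exI[of _ A]) (auto intro: sets_completionI_sets)
qed

lemma pair_sigma_finite_lebesgue:
  "pair_sigma_finite (lebesgue :: 'a::euclidean_space measure) (lebesgue :: 'b::euclidean_space measure)"
  by (intro pair_sigma_finite.intro sigma_finite_lebesgue)

lemma nn_integral_translate_lebesgue:
  fixes \<phi> :: "'a::euclidean_space \<Rightarrow> ennreal"
  assumes [measurable]: "\<phi> \<in> borel_measurable lebesgue"
  shows "(\<integral>\<^sup>+y. \<phi> (x + y) \<partial>lebesgue) = (\<integral>\<^sup>+z. \<phi> z \<partial>lebesgue)"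
proof -
  have eq: "(\<lambda>y. x + (\<Sum>j\<in>Basis. (1 * (y \<bullet> j)) *\<^sub>R j)) = (+) x"
    by (simp add: euclidean_representation fun_eq_iff)
  have m: "(+) x \<in> lebesgue \<rightarrow>\<^sub>M lebesgue"
    using lebesgue_affine_measurable[of "\<lambda>_. 1" x] unfolding eq by simp
  have "lebesgue = distr lebesgue lebesgue ((+) x)"
    using lebesgue_affine_euclidean[of "\<lambda>_. 1" x] unfolding eq by (simp add: density_1)
  then have "(\<integral>\<^sup>+z. \<phi> z \<partial>lebesgue) = (\<integral>\<^sup>+z. \<phi> z \<partial>distr lebesgue lebesgue ((+) x))"
    by simp
  also have "\<dots> = (\<integral>\<^sup>+y. \<phi> (x + y) \<partial>lebesgue)"
    by (rule nn_integral_distr[OF m]) simp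
  finally show ?thesis ..
qed

lemma ball_sets_lebesgue [measurable]: "ball x r \<in> sets lebesgue"
  by (simp add: fmeasurableD)

lemma avg_ball_translate:
  fixes \<phi> :: "real ^ 'n \<Rightarrow> ennreal"
  assumes [measurable]: "\<phi> \<in> borel_measurable lebesgue"
  shows "avg (ball 0 r) (\<lambda>y. \<phi> (x + y)) = (\<integral>\<^sup>+z\<in>ball x r. \<phi> z \<partial>lebesgue) / emeasure lebesgue (ball (0::real^'n) r)"
proof -
  have "(\<integral>\<^sup>+y\<in>ball 0 r. \<phi> (x + y) \<partial>lebesgue) = (\<integral>\<^sup>+y. \<phi> (x + y) * indicator (ball x r) (x + y) \<partial>lebesgue)"
    by (intro nn_integral_cong) (auto simp: indicator_def dist_norm)
  also have "\<dots> = (\<integral>\<^sup>+z\<in>ball x r. \<phi> z \<partial>lebesgue)"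
    by (rule nn_integral_translate_lebesgue) measurable
  finally show ?thesis by (simp add: avg_def)
qed

lemma emeasure_lebesgue_ball:
  fixes c :: "'a::euclidean_space"
  assumes "0 \<le> r"
  shows "emeasure lebesgue (ball c r) = ennreal (unit_ball_vol (DIM('a)) * r ^ DIM('a))"
  using emeasure_ball[OF assms, of c] by simp

text \<open>
  The set of pairs at distance less than \<open>r\<close> is a Borel set, so it is measurable for the product of the completed
  measures, and Tonelli's theorem applies to integrals over moving balls of Lebesgue measurable functions.
\<close>

lemma ball_pair_measurable:
  "(\<lambda>(x, z). indicator (ball x r) z :: ennreal) \<in>
    borel_measurable ((lebesgue :: 'a::euclidean_space measure) \<Otimes>\<^sub>M lebesgue)"
proof -
  have id: "(\<lambda>x::'a. x) \<in> lebesgue \<rightarrow>\<^sub>M borel"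
    by (rule measurable_completion) simp
  have [measurable]: "fst \<in> borel_measurable ((lebesgue :: 'a measure) \<Otimes>\<^sub>M (lebesgue :: 'a measure))"
      "snd \<in> borel_measurable ((lebesgue :: 'a measure) \<Otimes>\<^sub>M (lebesgue :: 'a measure))"
    using measurable_compose[OF measurable_fst id] measurable_compose[OF measurable_snd id] by auto
  have "(\<lambda>p. indicator {p \<in> space (lebesgue \<Otimes>\<^sub>M lebesgue). dist (fst p) (snd p) < r} p :: ennreal) \<in>
      borel_measurable ((lebesgue :: 'a measure) \<Otimes>\<^sub>M lebesgue)"
    by measurable
  then show ?thesis
    by (rule measurable_cong[THEN iffD1, rotated]) (auto simp: indicator_def)
qed

text \<open>
  The pointwise step of Hoelder's inequality with the weight split off:
  \<open>\<alpha> = (\<alpha> v\<^sup>1\<^sup>/\<^sup>q) v\<^sup>-\<^sup>1\<^sup>/\<^sup>q\<close>, and \<open>v\<^sup>-\<^sup>1\<^sup>/\<^sup>q\<close> raised to the conjugate exponent \<open>q'\<close> is \<open>v\<^sup>1\<^sup>-\<^sup>q\<^sup>'\<close>. Young's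
  inequality is applied to the two factors, which are normalized by the integrals \<open>i\<close> and \<open>j\<close> of their powers.
\<close>

lemma Young_weighted:
  fixes \<alpha> v i j q :: real
  assumes q: "1 < q" and "0 \<le> \<alpha>" "0 < v" "0 < i" "0 < j"
  shows "\<alpha> \<le> i powr (1 / q) * j powr (1 / conj_exp q) *
    (\<alpha> powr q * v * (1 / (q * i)) + v powr (1 - conj_exp q) * (1 / (conj_exp q * j)))"
proof -
  define q' where "q' = conj_exp q"
  have q': "1 < q'" and conj: "1 / q + 1 / q' = 1"
    using q conj_exp_eq[OF q] by (auto simp: q'_def conj_exp_def field_simps)
  have e: "1 / q' - 1 = - (1 / q)" using conj by simp
  define A where "A = \<alpha> * v powr (1 / q) * i powr (- (1 / q))"
  define B where "B = v powr (- (1 / q)) * j powr (- (1 / q'))"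
  have "A * B \<le> A powr q / q + B powr q' / q'"
    using assms q' conj by (intro Youngs_inequality) (auto simp: A_def B_def)
  moreover have "A powr q = \<alpha> powr q * v / i"
    using assms by (simp add: A_def powr_mult powr_powr powr_minus_divide powr_divide)
  moreover have "B powr q' = v powr (1 - q') / j"
  proof -
    have "- (1 / q) * q' = 1 - q'" using q' by (simp flip: e add: field_simps)
    moreover have "B powr q' = v powr (- (1 / q) * q') * j powr (- (1 / q') * q')"
      by (simp add: B_def powr_mult powr_powr)
    ultimately show ?thesis
      using assms q' by (simp add: powr_minus_divide)
  qed
  moreover have "\<alpha> = i powr (1 / q) * j powr (1 / q') * (A * B)"
    using assms by (simp add: A_def B_def powr_minus field_simps)
  ultimately have "\<alpha> \<le> i powr (1 / q) * j powr (1 / q') * (\<alpha> powr q * v / i / q + v powr (1 - q') / j / q')"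
    by (metis mult_left_mono mult_nonneg_nonneg powr_ge_zero)
  then show ?thesis by (simp add: q'_def mult.commute)
qed

lemma weighted_Hoelder:
  fixes a :: "'a \<Rightarrow> ennreal" and w :: "'a \<Rightarrow> real"
  assumes q: "1 < q" and [measurable]: "a \<in> borel_measurable M" "w \<in> borel_measurable M"
    and w: "AE x in M. 0 < w x"
  shows "ennpowr (\<integral>\<^sup>+x. a x \<partial>M) q \<le>
    (\<integral>\<^sup>+x. ennpowr (a x) q * ennreal (w x) \<partial>M) *
    ennpowr (\<integral>\<^sup>+x. ennreal (w x powr (1 - conj_exp q)) \<partial>M) (q - 1)"
proof -
  define I where "I = (\<integral>\<^sup>+x. ennpowr (a x) q * ennreal (w x) \<partial>M)"
  define J where "J = (\<integral>\<^sup>+x. ennreal (w x powr (1 - conj_exp q)) \<partial>M)"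
  define q' where "q' = conj_exp q"
  have q': "1 < q'" and conj: "1 / q + 1 / q' = 1"
    using q conj_exp_eq[OF q] by (auto simp: q'_def conj_exp_def field_simps)
  consider "I = 0" | "J = 0" | "I \<noteq> 0" "J \<noteq> 0" "I = top \<or> J = top" | "I \<noteq> 0" "J \<noteq> 0" "I < top" "J < top"
    by (metis less_top)
  then have "ennpowr (\<integral>\<^sup>+x. a x \<partial>M) q \<le> I * ennpowr J (q - 1)"
  proof cases
    case 1
    then have "AE x in M. ennpowr (a x) q * ennreal (w x) = 0"
      by (simp add: I_def nn_integral_0_iff_AE)
    with w have "AE x in M. a x = 0"
      by eventually_elim (auto simp: ennpowr_eq_0_iff)
    then have "(\<integral>\<^sup>+x. a x \<partial>M) = 0" by (simp add: nn_integral_0_iff_AE)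
    then show ?thesis by simp
  next
    case 2
    then have "AE x in M. ennreal (w x powr (1 - conj_exp q)) = 0"
      by (simp add: J_def nn_integral_0_iff_AE)
    with w have "AE x in M. a x = 0"
      by eventually_elim auto
    then have "(\<integral>\<^sup>+x. a x \<partial>M) = 0" by (simp add: nn_integral_0_iff_AE)
    then show ?thesis by simp
  next
    case 3
    then have "I * ennpowr J (q - 1) = top"
      by (auto simp: ennreal_mult_eq_top_iff ennpowr_eq_0_iff)
    then show ?thesis by simp
  next
    case 4
    then obtain i j where ij: "0 < i" "0 < j" "I = ennreal i" "J = ennreal j"
      using that[of "enn2real I" "enn2real J"]
      by (auto simp: enn2real_positive_iff zero_less_iff_neq_zero)
    define c where "c = i powr (1 / q) * j powr (1 / q')"
    have c: "0 < c" using ij by (simp add: c_def)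
    have "AE x in M. a x \<le> ennreal c * (ennpowr (a x) q * ennreal (w x) * ennreal (1 / (q * i)) +
        ennreal (w x powr (1 - q')) * ennreal (1 / (q' * j)))"
      using w
    proof eventually_elim
      fix x assume wx: "0 < w x"
      show "a x \<le> ennreal c * (ennpowr (a x) q * ennreal (w x) * ennreal (1 / (q * i)) +
        ennreal (w x powr (1 - q')) * ennreal (1 / (q' * j)))"
      proof (cases "a x")
        case (real \<alpha>)
        then show ?thesis
          using Young_weighted[OF q real(1) wx ij(1,2)] wx q q' ij
          by (simp add: ennpowr_ennreal c_def q'_def ennreal_le_iff flip: ennreal_mult ennreal_plus)
      next
        case top
        then show ?thesis
          using wx q ij c by (simp add: ennreal_top_mult ennreal_mult_top)
      qed
    qed
    then have "(\<integral>\<^sup>+x. a x \<partial>M) \<le> (\<integral>\<^sup>+x. ennreal c * (ennpowr (a x) q * ennreal (w x) * ennreal (1 / (q * i)) +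
        ennreal (w x powr (1 - q')) * ennreal (1 / (q' * j))) \<partial>M)"
      by (rule nn_integral_mono_AE)
    also have "\<dots> = ennreal c * (I * ennreal (1 / (q * i)) + J * ennreal (1 / (q' * j)))"
      unfolding I_def J_def q'_def
      by (subst nn_integral_cmult) (auto simp: nn_integral_add nn_integral_multc)
    also have "\<dots> = ennreal c"
    proof -
      have "i * (1 / (q * i)) + j * (1 / (q' * j)) = 1" using ij conj by simp
      then show ?thesis
        using ij q q' c by (simp flip: ennreal_mult ennreal_plus)
    qed
    finally have "ennpowr (\<integral>\<^sup>+x. a x \<partial>M) q \<le> ennpowr (ennreal c) q"
      using q by (intro ennpowr_mono) auto
    also have "\<dots> = ennreal (i * j powr (q - 1))"
    proof -
      have "1 / q' * q = q - 1" using conj q q' by (simp add: field_simps)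
      then show ?thesis using ij q c by (simp add: ennpowr_ennreal c_def powr_mult powr_powr)
    qed
    also have "\<dots> = I * ennpowr J (q - 1)"
      using ij by (simp add: ennpowr_ennreal ennreal_mult)
    finally show ?thesis .
  qed
  then show ?thesis by (simp add: I_def J_def)
qed

lemma A_class_is_weight: "w \<in> A_class q \<Longrightarrow> is_weight w"
  by (simp add: A_class_def)

lemma emeasure_cube:
  fixes a :: "real ^ 'n"
  assumes "0 < l"
  shows "emeasure lebesgue (cbox a (\<chi> i. a $ i + l)) = ennreal (l ^ CARD('n))"
proof -
  have "emeasure lebesgue (cbox a (\<chi> i. a $ i + l)) = ennreal (measure lebesgue (cbox a (\<chi> i. a $ i + l)))"
    by (subst emeasure_eq_ennreal_measure) (use emeasure_lborel_cbox_finite[of a "\<chi> i. a $ i + l"] in auto)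
  also have "measure lebesgue (cbox a (\<chi> i. a $ i + l)) = l ^ CARD('n)"
    using assms by (subst measure_completion) (auto simp: content_cbox_cart interval_ne_empty_cart)
  finally show ?thesis .
qed

lemma ball_subset_cube:
  fixes z :: "real ^ 'n"
  shows "ball z \<rho> \<subseteq> cbox (\<chi> i. z $ i - \<rho>) (\<chi> i. (\<chi> i. z $ i - \<rho>) $ i + 2 * \<rho>)"
proof
  fix x assume "x \<in> ball z \<rho>"
  then have "\<bar>(x - z) $ i\<bar> < \<rho>" for i
    using component_le_norm_cart[of "x - z" i] by (simp add: dist_norm norm_minus_commute)
  then show "x \<in> cbox (\<chi> i. z $ i - \<rho>) (\<chi> i. (\<chi> i. z $ i - \<rho>) $ i + 2 * \<rho>)"
    by (auto simp: mem_box_cart abs_less_iff) (smt (verit, best))+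
qed

lemma set_nn_integral_mono_set:
  "A \<subseteq> B \<Longrightarrow> (\<integral>\<^sup>+x\<in>A. f x \<partial>M) \<le> (\<integral>\<^sup>+x\<in>B. f x \<partial>M)"
  by (intro nn_integral_mono) (auto simp: indicator_def)

lemma set_nn_integral_pos:
  assumes [measurable]: "f \<in> borel_measurable M" "A \<in> sets M"
    and f: "AE x in M. 0 < f x" and A: "emeasure M A \<noteq> 0"
  shows "0 < (\<integral>\<^sup>+x\<in>A. f x \<partial>M :: ennreal)"
proof (rule ccontr)
  assume "\<not> ?thesis"
  then have "AE x in M. f x * indicator A x = 0"
    by (simp add: nn_integral_0_iff_AE)
  with f have "AE x in M. x \<notin> A"
    by eventually_elim (auto simp: indicator_def split: if_splits)
  then have "emeasure M A = 0"
    by (subst (asm) AE_iff_measurable[OF assms(2)]) (use sets.sets_into_space[OF assms(2)] in auto)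
  with A show False by simp
qed

text \<open>
  The Muckenhoupt condition with integrals in place of averages; the two normalizing factors
  \<open>|Q|\<close> and \<open>|Q|\<^sup>q\<^sup>-\<^sup>1\<close> combine to \<open>|Q|\<^sup>q\<close>.
\<close>

lemma A_class_cube_bound:
  fixes w :: "real ^ 'n \<Rightarrow> real"
  assumes w: "w \<in> A_class q" and q: "1 < q"
  shows "\<exists>K::real>0. \<forall>a l. 0 < l \<longrightarrow> (\<integral>\<^sup>+x\<in>cbox a (\<chi> i. a $ i + l). ennreal (w x) \<partial>lebesgue) *
      ennpowr (\<integral>\<^sup>+x\<in>cbox a (\<chi> i. a $ i + l). ennreal (w x powr (1 - conj_exp q)) \<partial>lebesgue) (q - 1) \<le>
      ennreal (K * (l ^ CARD('n)) powr q)"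
proof -
  define S where "S = (SUP Q\<in>cubes. avg Q (\<lambda>x. ennreal (w x)) *
        ennpowr (avg Q (\<lambda>x. ennreal (w x powr (1 - conj_exp q)))) (q - 1))"
  have "S < \<infinity>" using w by (simp add: A_class_def S_def)
  then obtain s where s: "0 \<le> s" "S = ennreal s" by (cases S) auto
  show ?thesis
  proof (intro exI conjI allI impI)
    show "0 < s + 1" using s by simp
    fix a :: "real ^ 'n" and l :: real assume l: "0 < l"
    let ?Q = "cbox a (\<chi> i. a $ i + l)"
    define v where "v = l ^ CARD('n)"
    have v: "0 < v" "emeasure lebesgue ?Q = ennreal v" using l emeasure_cube[OF l, of a] by (auto simp: v_def)
    have restore: "(\<integral>\<^sup>+x\<in>?Q. g x \<partial>lebesgue) = avg ?Q g * ennreal v" for g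
    proof -
      have "ennreal v / ennreal v = 1" using v(1) by (subst divide_ennreal) auto
      then show ?thesis unfolding avg_def v(2) ennreal_divide_times by simp
    qed
    have "?Q \<in> cubes" using l by (auto simp: cubes_def)
    then have "avg ?Q (\<lambda>x. ennreal (w x)) * ennpowr (avg ?Q (\<lambda>x. ennreal (w x powr (1 - conj_exp q)))) (q - 1) \<le> S"
      unfolding S_def by (rule SUP_upper)
    then have le: "avg ?Q (\<lambda>x. ennreal (w x)) * ennpowr (avg ?Q (\<lambda>x. ennreal (w x powr (1 - conj_exp q)))) (q - 1) \<le> ennreal (s + 1)"
      using s by (auto intro: order_trans ennreal_leI)
    have "(\<integral>\<^sup>+x\<in>?Q. ennreal (w x) \<partial>lebesgue) *
      ennpowr (\<integral>\<^sup>+x\<in>?Q. ennreal (w x powr (1 - conj_exp q)) \<partial>lebesgue) (q - 1) =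
      (avg ?Q (\<lambda>x. ennreal (w x)) * ennpowr (avg ?Q (\<lambda>x. ennreal (w x powr (1 - conj_exp q)))) (q - 1)) *
      (ennreal v * ennpowr (ennreal v) (q - 1))"
      unfolding restore ennpowr_mult by (simp only: mult_ac)
    also have "\<dots> \<le> ennreal (s + 1) * (ennreal v * ennpowr (ennreal v) (q - 1))"
      by (rule mult_right_mono[OF le]) simp
    also have "ennreal v * ennpowr (ennreal v) (q - 1) = ennreal (v powr q)"
      using v(1) ennpowr_add_exp[of "ennreal v" 1 "q - 1"] by (simp add: ennpowr_ennreal)
    also have "ennreal (s + 1) * ennreal (v powr q) = ennreal ((s + 1) * v powr q)"
      using s by (subst ennreal_mult) auto
    finally show "(\<integral>\<^sup>+x\<in>?Q. ennreal (w x) \<partial>lebesgue) *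
      ennpowr (\<integral>\<^sup>+x\<in>?Q. ennreal (w x powr (1 - conj_exp q)) \<partial>lebesgue) (q - 1) \<le>
      ennreal ((s + 1) * (l ^ CARD('n)) powr q)"
      by (simp only: v_def)
  qed
qed

text \<open>
  The average of \<open>w\<^sup>1\<^sup>-\<^sup>q\<^sup>'\<close> over a cube is positive, so the product in the Muckenhoupt condition can be
  finite only if the average of \<open>w\<close> is.
\<close>

lemma A_class_locally_integrable:
  fixes w :: "real ^ 'n \<Rightarrow> real"
  assumes w: "w \<in> A_class q" and q: "1 < q"
  shows "(\<integral>\<^sup>+x\<in>ball z \<rho>. ennreal (w x) \<partial>lebesgue) < top"
proof (cases "0 < \<rho>")
  case True
  have [measurable]: "w \<in> borel_measurable lebesgue" and pos: "AE x in lebesgue. 0 < w x"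
    using A_class_is_weight[OF w] by (auto simp: is_weight_def)
  obtain K where K: "\<And>a l. 0 < l \<Longrightarrow> (\<integral>\<^sup>+x\<in>cbox a (\<chi> i. a $ i + l). ennreal (w x) \<partial>lebesgue) *
      ennpowr (\<integral>\<^sup>+x\<in>cbox a (\<chi> i. a $ i + l). ennreal (w x powr (1 - conj_exp q)) \<partial>lebesgue) (q - 1) \<le>
      ennreal (K * (l ^ CARD('n)) powr q)"
    using A_class_cube_bound[OF w q] by blast
  define a :: "real ^ 'n" where "a = (\<chi> i. z $ i - \<rho>)"
  let ?Q = "cbox a (\<chi> i. a $ i + 2 * \<rho>)"
  have "0 < (\<integral>\<^sup>+x\<in>?Q. ennreal (w x powr (1 - conj_exp q)) \<partial>lebesgue)"
  proof (rule set_nn_integral_pos)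
    show "AE x in lebesgue. 0 < ennreal (w x powr (1 - conj_exp q))"
      using pos by eventually_elim simp
    show "emeasure lebesgue ?Q \<noteq> 0" using True by (subst emeasure_cube) auto
  qed auto
  then have "ennpowr (\<integral>\<^sup>+x\<in>?Q. ennreal (w x powr (1 - conj_exp q)) \<partial>lebesgue) (q - 1) \<noteq> 0"
    by (simp add: ennpowr_eq_0_iff)
  moreover have "(\<integral>\<^sup>+x\<in>?Q. ennreal (w x) \<partial>lebesgue) *
      ennpowr (\<integral>\<^sup>+x\<in>?Q. ennreal (w x powr (1 - conj_exp q)) \<partial>lebesgue) (q - 1) < top"
    using K[of "2 * \<rho>" a] True by (auto intro: le_less_trans)
  ultimately have "(\<integral>\<^sup>+x\<in>?Q. ennreal (w x) \<partial>lebesgue) < top"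
    by (auto simp: ennreal_mult_less_top)
  moreover have "(\<integral>\<^sup>+x\<in>ball z \<rho>. ennreal (w x) \<partial>lebesgue) \<le> (\<integral>\<^sup>+x\<in>?Q. ennreal (w x) \<partial>lebesgue)"
    unfolding a_def by (intro set_nn_integral_mono_set ball_subset_cube)
  ultimately show ?thesis by (rule order.strict_trans1[rotated])
qed (simp add: ball_empty not_less)

lemma ball_integral_measurable:
  fixes F :: "'a::euclidean_space \<Rightarrow> 'a \<Rightarrow> ennreal"
  assumes [measurable]: "case_prod F \<in> borel_measurable (lebesgue \<Otimes>\<^sub>M lebesgue)"
  shows "(\<lambda>x. \<integral>\<^sup>+z\<in>ball x r. F x z \<partial>lebesgue) \<in> borel_measurable lebesgue"
proof (rule sigma_finite_measure.borel_measurable_nn_integral[OF sigma_finite_lebesgue])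
  have "(\<lambda>p. case_prod F p * (case p of (x, z) \<Rightarrow> indicator (ball x r) z)) \<in> borel_measurable (lebesgue \<Otimes>\<^sub>M lebesgue)"
    by (rule borel_measurable_times_ennreal[OF assms ball_pair_measurable])
  then show "(\<lambda>(x, z). F x z * indicator (ball x r) z) \<in> borel_measurable (lebesgue \<Otimes>\<^sub>M lebesgue)"
    by (simp add: case_prod_unfold)
qed

lemma weighted_Hoelder_set:
  fixes a :: "'a \<Rightarrow> ennreal" and w :: "'a \<Rightarrow> real"
  assumes q: "1 < q" and [measurable]: "a \<in> borel_measurable M" "w \<in> borel_measurable M" "A \<in> sets M"
    and w: "AE x in M. 0 < w x"
  shows "ennpowr (\<integral>\<^sup>+x\<in>A. a x \<partial>M) q \<le>
    (\<integral>\<^sup>+x\<in>A. ennpowr (a x) q * ennreal (w x) \<partial>M) *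
    ennpowr (\<integral>\<^sup>+x\<in>A. ennreal (w x powr (1 - conj_exp q)) \<partial>M) (q - 1)"
proof -
  have "AE x in restrict_space M A. 0 < w x"
    using w by (subst AE_restrict_space_iff) (auto elim: eventually_mono)
  from weighted_Hoelder[OF q _ _ this, of a] show ?thesis
    by (simp add: nn_integral_restrict_space measurable_restrict_space1)
qed

text \<open>
  Hoelder's inequality bounds the power of the average at \<open>x\<close> by an integral over \<open>z \<in> B(x, r)\<close>. After
  the integrals are exchanged, \<open>x\<close> ranges over \<open>B(z, r)\<close>, and all the balls that occur lie in
  one cube around \<open>z\<close> of side \<open>4 r\<close>, where the Muckenhoupt condition applies.
\<close>

lemma ball_average_bounded:
  fixes w :: "real ^ 'n \<Rightarrow> real"
  assumes w: "w \<in> A_class q" and q: "1 < q"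
  shows "\<exists>K::real>0. \<forall>h\<in>borel_measurable lebesgue. \<forall>r>0.
    (\<integral>\<^sup>+x. ennpowr ((\<integral>\<^sup>+z\<in>ball x r. h z \<partial>lebesgue) / emeasure lebesgue (ball (0::real^'n) r)) q * ennreal (w x) \<partial>lebesgue)
    \<le> ennreal K * (\<integral>\<^sup>+x. ennpowr (h x) q * ennreal (w x) \<partial>lebesgue)"
proof -
  have [measurable]: "w \<in> borel_measurable lebesgue" and pos: "AE x in lebesgue. 0 < w x"
    using A_class_is_weight[OF w] by (auto simp: is_weight_def)
  obtain K where K: "0 < K" "\<And>a l. 0 < l \<Longrightarrow> (\<integral>\<^sup>+x\<in>cbox a (\<chi> i. a $ i + l). ennreal (w x) \<partial>lebesgue) *
      ennpowr (\<integral>\<^sup>+x\<in>cbox a (\<chi> i. a $ i + l). ennreal (w x powr (1 - conj_exp q)) \<partial>lebesgue) (q - 1) \<le>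
      ennreal (K * (l ^ CARD('n)) powr q)"
    using A_class_cube_bound[OF w q] by blast
  define n where "n = CARD('n)"
  define ub where "ub = unit_ball_vol (real n)"
  have ub: "0 < ub" by (simp add: ub_def)
  show ?thesis
  proof (intro exI conjI ballI allI impI)
    show "0 < K * (4 ^ n / ub) powr q" using K(1) ub by simp
    fix h :: "real ^ 'n \<Rightarrow> ennreal" and r :: real
    assume [measurable]: "h \<in> borel_measurable lebesgue" and r: "0 < r"
    define H where "H z = ennpowr (h z) q * ennreal (w z)" for z
    define \<sigma> where "\<sigma> z = ennreal (w z powr (1 - conj_exp q))" for z
    define S where "S x = ennpowr (\<integral>\<^sup>+z\<in>ball x r. \<sigma> z \<partial>lebesgue) (q - 1)" for x
    have [measurable]: "H \<in> borel_measurable lebesgue" "\<sigma> \<in> borel_measurable lebesgue"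
      by (simp_all add: H_def[abs_def] \<sigma>_def[abs_def])
    have [measurable]: "S \<in> borel_measurable lebesgue"
      unfolding S_def[abs_def] by (intro measurable_ennpowr ball_integral_measurable) simp
    define V where "V = ub * r ^ n"
    have V: "0 < V" using ub r by (simp add: V_def)
    have ball: "emeasure lebesgue (ball (0::real^'n) r) = ennreal V"
      using emeasure_lebesgue_ball[of r "0::real^'n"] r by (simp add: V_def ub_def n_def)
    have scale: "ennpowr (X / ennreal V) q = ennpowr X q * ennreal ((1 / V) powr q)" for X
      using V by (simp add: divide_ennreal_def inverse_ennreal ennpowr_mult ennpowr_ennreal inverse_eq_divide)
    have inner: "(\<integral>\<^sup>+x. indicator (ball x r) z * (S x * ennreal (w x)) \<partial>lebesgue) \<le>
        ennreal (K * ((4 * r) ^ n) powr q)" for z :: "real ^ 'n"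
    proof -
      define a where "a = (\<chi> i. z $ i - 2 * r)"
      let ?P = "cbox a (\<chi> i. a $ i + 4 * r)"
      have [measurable]: "?P \<in> sets lebesgue" by simp
      have P: "ball z (2 * r) \<subseteq> ?P"
        using ball_subset_cube[of z "2 * r"] by (simp add: a_def)
      have "indicator (ball x r) z * (S x * ennreal (w x)) \<le>
          ennpowr (\<integral>\<^sup>+y\<in>?P. \<sigma> y \<partial>lebesgue) (q - 1) * (ennreal (w x) * indicator ?P x)" for x
      proof (cases "z \<in> ball x r")
        case True
        have "ball x r \<subseteq> ball z (2 * r)"
        proof
          fix y assume "y \<in> ball x r"
          with True show "y \<in> ball z (2 * r)"
            using dist_triangle[of z y x] by (simp add: dist_commute)
        qed
        then have "S x \<le> ennpowr (\<integral>\<^sup>+y\<in>?P. \<sigma> y \<partial>lebesgue) (q - 1)"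
          unfolding S_def using P q by (intro ennpowr_mono set_nn_integral_mono_set) auto
        moreover have "x \<in> ?P"
          using True P r by (auto simp: dist_commute)
        ultimately show ?thesis using True by (simp add: mult_right_mono)
      qed simp
      then have "(\<integral>\<^sup>+x. indicator (ball x r) z * (S x * ennreal (w x)) \<partial>lebesgue) \<le>
          (\<integral>\<^sup>+x. ennpowr (\<integral>\<^sup>+y\<in>?P. \<sigma> y \<partial>lebesgue) (q - 1) * (ennreal (w x) * indicator ?P x) \<partial>lebesgue)"
        by (intro nn_integral_mono)
      also have "\<dots> = ennpowr (\<integral>\<^sup>+y\<in>?P. \<sigma> y \<partial>lebesgue) (q - 1) * (\<integral>\<^sup>+x\<in>?P. ennreal (w x) \<partial>lebesgue)"
        by (rule nn_integral_cmult) measurable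
      also have "\<dots> = (\<integral>\<^sup>+x\<in>?P. ennreal (w x) \<partial>lebesgue) * ennpowr (\<integral>\<^sup>+y\<in>?P. \<sigma> y \<partial>lebesgue) (q - 1)"
        by (rule mult.commute)
      also have "\<dots> \<le> ennreal (K * ((4 * r) ^ n) powr q)"
        using K(2)[of "4 * r" a] r by (simp add: \<sigma>_def n_def)
      finally show ?thesis .
    qed
    have "(\<integral>\<^sup>+x. ennpowr ((\<integral>\<^sup>+z\<in>ball x r. h z \<partial>lebesgue) / ennreal V) q * ennreal (w x) \<partial>lebesgue) \<le>
        (\<integral>\<^sup>+x. ennreal ((1 / V) powr q) *
          (\<integral>\<^sup>+z. H z * (indicator (ball x r) z * (S x * ennreal (w x))) \<partial>lebesgue) \<partial>lebesgue)"
    proof (rule nn_integral_mono)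
      fix x :: "real ^ 'n"
      have "ennpowr (\<integral>\<^sup>+z\<in>ball x r. h z \<partial>lebesgue) q \<le> (\<integral>\<^sup>+z\<in>ball x r. H z \<partial>lebesgue) * S x"
        unfolding H_def S_def \<sigma>_def by (intro weighted_Hoelder_set q pos) measurable
      then have "ennreal ((1 / V) powr q) * (ennpowr (\<integral>\<^sup>+z\<in>ball x r. h z \<partial>lebesgue) q * ennreal (w x)) \<le>
          ennreal ((1 / V) powr q) * (((\<integral>\<^sup>+z\<in>ball x r. H z \<partial>lebesgue) * S x) * ennreal (w x))"
        by (intro mult_left_mono mult_right_mono) auto
      also have "((\<integral>\<^sup>+z\<in>ball x r. H z \<partial>lebesgue) * S x) * ennreal (w x) =
          (\<integral>\<^sup>+z. H z * (indicator (ball x r) z * (S x * ennreal (w x))) \<partial>lebesgue)"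
        unfolding mult.assoc[of "integral\<^sup>N _ _"]
        by (subst nn_integral_multc[symmetric]) (auto simp: mult.assoc)
      finally show "ennpowr ((\<integral>\<^sup>+z\<in>ball x r. h z \<partial>lebesgue) / ennreal V) q * ennreal (w x) \<le>
          ennreal ((1 / V) powr q) *
            (\<integral>\<^sup>+z. H z * (indicator (ball x r) z * (S x * ennreal (w x))) \<partial>lebesgue)"
        by (simp add: scale mult_ac)
    qed
    also have "\<dots> = ennreal ((1 / V) powr q) * (\<integral>\<^sup>+x.
          (\<integral>\<^sup>+z. H z * (indicator (ball x r) z * (S x * ennreal (w x))) \<partial>lebesgue) \<partial>lebesgue)"
    proof (rule nn_integral_cmult)
      have "(\<lambda>x. \<integral>\<^sup>+z\<in>ball x r. H z * (S x * ennreal (w x)) \<partial>lebesgue) \<in> borel_measurable lebesgue"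
        by (rule ball_integral_measurable) measurable
      then show "(\<lambda>x. \<integral>\<^sup>+z. H z * (indicator (ball x r) z * (S x * ennreal (w x))) \<partial>lebesgue) \<in> borel_measurable lebesgue"
        by (simp add: mult_ac)
    qed
    also have "(\<integral>\<^sup>+x. (\<integral>\<^sup>+z. H z * (indicator (ball x r) z * (S x * ennreal (w x))) \<partial>lebesgue) \<partial>lebesgue) =
        (\<integral>\<^sup>+z. (\<integral>\<^sup>+x. H z * (indicator (ball x r) z * (S x * ennreal (w x))) \<partial>lebesgue) \<partial>lebesgue)"
    proof (rule pair_sigma_finite.Fubini'[OF pair_sigma_finite_lebesgue, symmetric])
      have "(\<lambda>p. H (snd p) * ((case p of (x, z) \<Rightarrow> indicator (ball x r) z) * (S (fst p) * ennreal (w (fst p))))) \<in>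
          borel_measurable (lebesgue \<Otimes>\<^sub>M lebesgue)"
        by (intro borel_measurable_times_ennreal ball_pair_measurable) measurable
      then show "(\<lambda>(x, z). H z * (indicator (ball x r) z * (S x * ennreal (w x)))) \<in>
          borel_measurable (lebesgue \<Otimes>\<^sub>M lebesgue)"
        by (simp add: case_prod_unfold)
    qed
    also have "\<dots> \<le> (\<integral>\<^sup>+z. ennreal (K * ((4 * r) ^ n) powr q) * H z \<partial>lebesgue)"
    proof (rule nn_integral_mono)
      fix z :: "real ^ 'n"
      have "(\<lambda>x. indicator (ball x r) z :: ennreal) = indicator (ball z r)"
        by (auto simp: indicator_def dist_commute fun_eq_iff)
      then have [measurable]: "(\<lambda>x. indicator (ball x r) z :: ennreal) \<in> borel_measurable lebesgue"
        by simp
      have "(\<integral>\<^sup>+x. H z * (indicator (ball x r) z * (S x * ennreal (w x))) \<partial>lebesgue) =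
          H z * (\<integral>\<^sup>+x. indicator (ball x r) z * (S x * ennreal (w x)) \<partial>lebesgue)"
        by (rule nn_integral_cmult) measurable
      also have "\<dots> \<le> H z * ennreal (K * ((4 * r) ^ n) powr q)"
        by (intro mult_left_mono inner) simp
      finally show "(\<integral>\<^sup>+x. H z * (indicator (ball x r) z * (S x * ennreal (w x))) \<partial>lebesgue) \<le>
          ennreal (K * ((4 * r) ^ n) powr q) * H z"
        by (simp add: mult.commute)
    qed
    also have "\<dots> = ennreal (K * ((4 * r) ^ n) powr q) * (\<integral>\<^sup>+z. H z \<partial>lebesgue)"
      by (rule nn_integral_cmult) measurable
    also have "ennreal ((1 / V) powr q) * (ennreal (K * ((4 * r) ^ n) powr q) * (\<integral>\<^sup>+z. H z \<partial>lebesgue)) =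
        ennreal (K * (4 ^ n / ub) powr q) * (\<integral>\<^sup>+z. H z \<partial>lebesgue)"
    proof -
      have "(1 / V) powr q * (K * ((4 * r) ^ n) powr q) = K * ((1 / V) * (4 * r) ^ n) powr q"
        using V r by (subst powr_mult) auto
      also have "(1 / V) * (4 * r) ^ n = 4 ^ n / ub"
        using ub r by (simp add: V_def power_mult_distrib)
      finally have eq: "(1 / V) powr q * (K * ((4 * r) ^ n) powr q) = K * (4 ^ n / ub) powr q" .
      have "ennreal ((1 / V) powr q) * (ennreal (K * ((4 * r) ^ n) powr q) * X) =
          ennreal ((1 / V) powr q * (K * ((4 * r) ^ n) powr q)) * X" for X
        using K(1) by (subst ennreal_mult) (auto simp: mult.assoc)
      then show ?thesis unfolding eq .
    qed
    finally show "(\<integral>\<^sup>+x. ennpowr ((\<integral>\<^sup>+z\<in>ball x r. h z \<partial>lebesgue) / emeasure lebesgue (ball (0::real^'n) r)) q * ennreal (w x) \<partial>lebesgue)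
      \<le> ennreal (K * (4 ^ n / ub) powr q) * (\<integral>\<^sup>+x. ennpowr (h x) q * ennreal (w x) \<partial>lebesgue)"
      unfolding ball H_def by (simp add: mult_left_mono)
  qed
qed

section \<open>Mean oscillation over small balls\<close>

definition oscillation ::
  "real \<Rightarrow> (real ^ 'n \<Rightarrow> 'k::{real_normed_field,euclidean_space}) \<Rightarrow> real \<Rightarrow> real ^ 'n \<Rightarrow> ennreal" where
  "oscillation s f r x = (\<integral>\<^sup>+z\<in>ball x r. ennreal (norm (f x - f z) powr s) \<partial>lebesgue) /
    emeasure lebesgue (ball (0 :: real ^ 'n) r)"

text \<open>
  For \<open>s = p / q\<close> this is the integral in the third condition of the criterion.
\<close>

definition oscillation_modular ::
  "real \<Rightarrow> real \<Rightarrow> (real ^ 'n \<Rightarrow> real) \<Rightarrow> (real ^ 'n \<Rightarrow> 'k::{real_normed_field,euclidean_space}) \<Rightarrow> real \<Rightarrow> ennreal" where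
  "oscillation_modular s q w f r = (\<integral>\<^sup>+x. ennpowr (oscillation s f r x) q * ennreal (w x) \<partial>lebesgue)"

lemma avg_eq_oscillation:
  assumes [measurable]: "f \<in> borel_measurable lebesgue"
  shows "avg (ball 0 r) (\<lambda>y. ennreal (norm (f x - f (x + y)) powr s)) = oscillation s f r x"
  unfolding oscillation_def
  by (rule avg_ball_translate[of "\<lambda>z. ennreal (norm (f x - f z) powr s)"]) measurable

lemma oscillation_measurable:
  assumes [measurable]: "f \<in> borel_measurable lebesgue"
  shows "oscillation s f r \<in> borel_measurable lebesgue"
proof -
  have "(\<lambda>x. \<integral>\<^sup>+z\<in>ball x r. ennreal (norm (f x - f z) powr s) \<partial>lebesgue) \<in> borel_measurable lebesgue"
    by (rule ball_integral_measurable) measurable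
  then show ?thesis unfolding oscillation_def[abs_def] by measurable
qed

text \<open>
  The pointwise inequality \<open>|f(x) - f(z)|\<^sup>s \<le> 4\<^sup>s (|h(x)|\<^sup>s + |h(z)|\<^sup>s + |g(x) - g(z)|\<^sup>s)\<close> with \<open>h = f - g\<close> is averaged
  over \<open>z\<close>. The middle term becomes the ball average of \<open>|h|\<^sup>s\<close>, and its boundedness on \<open>L\<^sup>q(w)\<close> is where
  the Muckenhoupt condition enters.
\<close>

lemma oscillation_modular_perturb:
  fixes w :: "real ^ 'n \<Rightarrow> real"
  assumes s: "0 < s" and q: "1 < q" and w: "w \<in> A_class q"
  shows "\<exists>C::real>0. \<forall>f\<in>borel_measurable lebesgue.
    \<forall>g::real ^ 'n \<Rightarrow> 'k::{real_normed_field,euclidean_space}\<in>borel_measurable lebesgue. \<forall>r>0.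
    oscillation_modular s q w f r \<le> 
      ennreal C * (Lp_modular (s * q) w (\<lambda>x. f x - g x) + oscillation_modular s q w g r)"
proof -
  have [measurable]: "w \<in> borel_measurable lebesgue"
    using A_class_is_weight[OF w] by (auto simp: is_weight_def)
  obtain K :: real where K: "0 < K" "\<And>h r. h \<in> borel_measurable lebesgue \<Longrightarrow> 0 < r \<Longrightarrow>
    (\<integral>\<^sup>+x. ennpowr ((\<integral>\<^sup>+z\<in>ball x r. h z \<partial>lebesgue) / emeasure lebesgue (ball (0::real^'n) r)) q * ennreal (w x) \<partial>lebesgue)
    \<le> ennreal K * (\<integral>\<^sup>+x. ennpowr (h x) q * ennreal (w x) \<partial>lebesgue)"
    using ball_average_bounded[OF w q] by blast
  define D where "D = (4 powr s) powr q * 4 powr q"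
  have D: "0 < D" by (simp add: D_def)
  show ?thesis
  proof (intro exI conjI ballI allI impI)
    show "0 < D * (1 + K)" using D K by simp
    fix f g :: "real ^ 'n \<Rightarrow> 'k" and r :: real
    assume [measurable]: "f \<in> borel_measurable lebesgue" "g \<in> borel_measurable lebesgue" and r: "0 < r"
    note [measurable] = oscillation_measurable[of g]
    define h where "h x = ennreal (norm (f x - g x) powr s)" for x
    have [measurable]: "h \<in> borel_measurable lebesgue" by (simp add: h_def[abs_def])
    define V where "V = emeasure lebesgue (ball (0::real^'n) r)"
    have V: "emeasure lebesgue (ball x r) = V" "V \<noteq> 0" "V \<noteq> top" for x :: "real ^ 'n"
    proof -
      have "unit_ball_vol (real CARD('n)) \<noteq> 0"
        using unit_ball_vol_pos[of "real CARD('n)"] by linarith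
      then show "emeasure lebesgue (ball x r) = V" "V \<noteq> 0" "V \<noteq> top"
        using r by (auto simp: V_def emeasure_lebesgue_ball simp del: emeasure_completion)
    qed
    define A where "A x = (\<integral>\<^sup>+z\<in>ball x r. h z \<partial>lebesgue) / V" for x
    have [measurable]: "A \<in> borel_measurable lebesgue"
    proof -
      have "(\<lambda>x. \<integral>\<^sup>+z\<in>ball x r. h z \<partial>lebesgue) \<in> borel_measurable lebesgue"
        by (rule ball_integral_measurable) measurable
      then show ?thesis unfolding A_def[abs_def] by measurable
    qed
    have osc: "oscillation s f r x \<le> ennreal (4 powr s) * (h x + (A x + oscillation s g r x))" for x
    proof -
      have pt: "ennreal (norm (f x - f z) powr s) \<le>
          ennreal (4 powr s) * (h x + (h z + ennreal (norm (g x - g z) powr s)))" for z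
      proof -
        have "norm (f x - f z) powr s = norm ((f x - g x) + ((g z - f z) + (g x - g z))) powr s"
          by (simp add: algebra_simps)
        also have "\<dots> \<le> 2 powr s * (norm (f x - g x) powr s + norm ((g z - f z) + (g x - g z)) powr s)"
          using s by (intro norm_add_powr_le) simp
        also have "\<dots> \<le> 2 powr s * (2 powr s * norm (f x - g x) powr s +
            2 powr s * (norm (g z - f z) powr s + norm (g x - g z) powr s))"
          using s by (intro mult_left_mono add_mono norm_add_powr_le) (auto simp: ge_one_powr_ge_zero mult_le_cancel_right1)
        also have "\<dots> = 4 powr s * (norm (f x - g x) powr s + (norm (f z - g z) powr s + norm (g x - g z) powr s))"
          using powr_mult[of 2 2 s] by (simp add: algebra_simps norm_minus_commute)
        finally show ?thesis
          by (simp add: h_def ennreal_leI flip: ennreal_plus ennreal_mult)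
      qed
      have "(\<integral>\<^sup>+z\<in>ball x r. ennreal (norm (f x - f z) powr s) \<partial>lebesgue) \<le>
          (\<integral>\<^sup>+z. ennreal (4 powr s) * (h x * indicator (ball x r) z + (h z * indicator (ball x r) z +
            ennreal (norm (g x - g z) powr s) * indicator (ball x r) z)) \<partial>lebesgue)"
        by (intro nn_integral_mono) (use pt in \<open>auto simp: indicator_def\<close>)
      also have "\<dots> = ennreal (4 powr s) * (h x * V + ((\<integral>\<^sup>+z\<in>ball x r. h z \<partial>lebesgue) +
          (\<integral>\<^sup>+z\<in>ball x r. ennreal (norm (g x - g z) powr s) \<partial>lebesgue)))"
        by (subst nn_integral_cmult) (auto simp: nn_integral_add nn_integral_cmult_indicator V simp del: emeasure_completion)
      finally have "oscillation s f r x \<le> ennreal (4 powr s) * (h x * V + ((\<integral>\<^sup>+z\<in>ball x r. h z \<partial>lebesgue) +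
          (\<integral>\<^sup>+z\<in>ball x r. ennreal (norm (g x - g z) powr s) \<partial>lebesgue))) / V"
        unfolding oscillation_def V_def[symmetric] by (rule divide_right_mono_ennreal)
      also have "\<dots> = ennreal (4 powr s) * (h x + (A x + oscillation s g r x))"
        using V by (simp add: ennreal_times_divide[symmetric] add_divide_distrib_ennreal
            ennreal_divide_self less_top[symmetric] A_def oscillation_def V_def[symmetric] del: emeasure_completion)
      finally show ?thesis .
    qed
    have "ennpowr (oscillation s f r x) q \<le>
        ennreal D * (ennpowr (h x) q + (ennpowr (A x) q + ennpowr (oscillation s g r x) q))" for x
    proof -
      have 1: "1 \<le> ennreal (2 powr q)" using q by (simp add: ge_one_powr_ge_zero)
      have "ennpowr (oscillation s f r x) q \<le> ennpowr (ennreal (4 powr s) * (h x + (A x + oscillation s g r x))) q"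
        using q by (intro ennpowr_mono osc) simp
      also have "\<dots> = ennreal ((4 powr s) powr q) * ennpowr (h x + (A x + oscillation s g r x)) q"
        by (simp add: ennpowr_mult ennpowr_ennreal)
      also have "\<dots> \<le> ennreal ((4 powr s) powr q) * (ennreal (2 powr q) *
          (ennreal (2 powr q) * ennpowr (h x) q + ennreal (2 powr q) * (ennpowr (A x) q + ennpowr (oscillation s g r x) q)))"
        using q mult_right_mono[OF 1, of "ennpowr (h x) q"]
        by (intro mult_left_mono order_trans[OF ennpowr_sum_le] add_mono ennpowr_sum_le) auto
      also have "\<dots> = ennreal ((4 powr s) powr q) * (ennreal (2 powr q) * ennreal (2 powr q)) *
          (ennpowr (h x) q + (ennpowr (A x) q + ennpowr (oscillation s g r x) q))"
        by (simp add: algebra_simps)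
      also have "ennreal ((4 powr s) powr q) * (ennreal (2 powr q) * ennreal (2 powr q)) = ennreal D"
        using powr_mult[of 2 2 q] by (simp add: D_def flip: ennreal_mult)
      finally show ?thesis .
    qed
    then have "oscillation_modular s q w f r \<le> (\<integral>\<^sup>+x. ennreal D * (ennpowr (h x) q * ennreal (w x) +
        (ennpowr (A x) q * ennreal (w x) + ennpowr (oscillation s g r x) q * ennreal (w x))) \<partial>lebesgue)"
      unfolding oscillation_modular_def
      by (intro nn_integral_mono) (metis (no_types, lifting) distrib_right mult.assoc mult_right_mono zero_le)
    also have "\<dots> = ennreal D * ((\<integral>\<^sup>+x. ennpowr (h x) q * ennreal (w x) \<partial>lebesgue) +
        ((\<integral>\<^sup>+x. ennpowr (A x) q * ennreal (w x) \<partial>lebesgue) + oscillation_modular s q w g r))"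
      unfolding oscillation_modular_def
      by (subst nn_integral_cmult) (auto simp: nn_integral_add)
    also have "(\<integral>\<^sup>+x. ennpowr (h x) q * ennreal (w x) \<partial>lebesgue) = Lp_modular (s * q) w (\<lambda>x. f x - g x)"
      by (simp add: h_def ennpowr_ennreal powr_powr Lp_modular_def)
    also have "ennreal D * (Lp_modular (s * q) w (\<lambda>x. f x - g x) +
        ((\<integral>\<^sup>+x. ennpowr (A x) q * ennreal (w x) \<partial>lebesgue) + oscillation_modular s q w g r)) \<le>
        ennreal D * (Lp_modular (s * q) w (\<lambda>x. f x - g x) +
        (ennreal K * Lp_modular (s * q) w (\<lambda>x. f x - g x) + ennreal (1 + K) * oscillation_modular s q w g r))"
    proof (intro mult_left_mono add_mono order_refl)
      show "(\<integral>\<^sup>+x. ennpowr (A x) q * ennreal (w x) \<partial>lebesgue) \<le> ennreal K * Lp_modular (s * q) w (\<lambda>x. f x - g x)"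
        using K(2)[of h r] r by (simp add: A_def V_def h_def ennpowr_ennreal powr_powr Lp_modular_def)
      have "1 \<le> ennreal (1 + K)" using K(1) by simp
      from mult_right_mono[OF this, of "oscillation_modular s q w g r"]
      show "oscillation_modular s q w g r \<le> ennreal (1 + K) * oscillation_modular s q w g r" by simp
    qed simp
    also have "\<dots> = ennreal (D * (1 + K)) * (Lp_modular (s * q) w (\<lambda>x. f x - g x) + oscillation_modular s q w g r)"
      using D K by (simp add: ennreal_mult algebra_simps)
    finally show "oscillation_modular s q w f r \<le>
      ennreal (D * (1 + K)) * (Lp_modular (s * q) w (\<lambda>x. f x - g x) + oscillation_modular s q w g r)" .
  qed
qed

section \<open>Approximation by continuous functions of bounded support\<close>

lemma Lp_modular_tendsto_0:
  fixes w :: "real ^ 'n \<Rightarrow> real" and f :: "real ^ 'n \<Rightarrow> 'k::{real_normed_field,euclidean_space}"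
  assumes p: "0 < p" and [measurable]: "w \<in> borel_measurable lebesgue"
    "f \<in> borel_measurable lebesgue" "\<And>i::nat. g i \<in> borel_measurable lebesgue" "B \<in> borel_measurable lebesgue"
    and bound: "\<And>i. AE x in lebesgue. norm (f x - g i x) \<le> B x"
    and B: "(\<integral>\<^sup>+x. ennreal (B x powr p) * ennreal (w x) \<partial>lebesgue) < top"
    and conv: "AE x in lebesgue. (\<lambda>i. g i x) \<longlonglongrightarrow> f x"
  shows "(\<lambda>i. Lp_modular p w (\<lambda>x. f x - g i x)) \<longlonglongrightarrow> 0"
proof -
  have "(\<lambda>i. Lp_modular p w (\<lambda>x. f x - g i x)) \<longlonglongrightarrow> integral\<^sup>N lebesgue (\<lambda>x::real^'n. 0)"
    unfolding Lp_modular_def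
  proof (rule nn_integral_dominated_convergence)
    show "AE x in lebesgue. ennreal (norm (f x - g i x) powr p) * ennreal (w x) \<le>
        ennreal (B x powr p) * ennreal (w x)" for i
      using bound[of i]
      by eventually_elim (use p in \<open>auto intro!: mult_right_mono ennreal_leI powr_mono2\<close>)
    show "AE x in lebesgue. (\<lambda>i. ennreal (norm (f x - g i x) powr p) * ennreal (w x)) \<longlonglongrightarrow> 0"
      using conv
    proof eventually_elim
      fix x assume "(\<lambda>i. g i x) \<longlonglongrightarrow> f x"
      then have "(\<lambda>i. norm (f x - g i x) powr p * w x) \<longlonglongrightarrow> norm (f x - f x) powr p * w x"
        using p by (intro tendsto_intros tendsto_powr2) auto
      then have "(\<lambda>i. ennreal (norm (f x - g i x) powr p * w x)) \<longlonglongrightarrow> ennreal (norm (f x - f x) powr p * w x)"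
        by (rule tendsto_ennrealI)
      then show "(\<lambda>i. ennreal (norm (f x - g i x) powr p) * ennreal (w x)) \<longlonglongrightarrow> 0"
        by (simp add: ennreal_mult')
    qed
  qed (use B in auto)
  then show ?thesis by simp
qed

lemma AE_limit_of_continuous:
  fixes f :: "'a::euclidean_space \<Rightarrow> 'b::euclidean_space"
  assumes "f \<in> borel_measurable lebesgue"
  obtains g where "\<And>i::nat. continuous_on UNIV (g i)" "AE x in lebesgue. (\<lambda>i. g i x) \<longlonglongrightarrow> f x"
proof -
  have "f measurable_on UNIV"
    using assms by (intro lebesgue_measurable_imp_measurable_on) auto
  then obtain N g where N: "negligible N" and g: "\<And>i. continuous_on UNIV (g i)"
      "\<And>x. x \<notin> N \<Longrightarrow> (\<lambda>i. g i x) \<longlonglongrightarrow> f x"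
    unfolding measurable_on_def by auto
  have "AE x in lebesgue. (\<lambda>i. g i x) \<longlonglongrightarrow> f x"
    using N g(2) by (intro AE_I'[of N]) (auto simp: negligible_iff_null_sets)
  with g(1) show ?thesis by (rule that)
qed

text \<open>
  A measurable function is an almost everywhere limit of continuous functions, but without any
  domination. The function is first cut off in size and support; the continuous approximants can then be
  clamped to the same size and multiplied by a continuous cut-off without changing their limit.
\<close>

lemma Lp_approx_continuous:
  fixes w :: "real ^ 'n \<Rightarrow> real" and f :: "real ^ 'n \<Rightarrow> 'k::{real_normed_field,euclidean_space}"
  assumes p: "0 < p" and [measurable]: "w \<in> borel_measurable lebesgue"
    and loc: "\<And>\<rho>. (\<integral>\<^sup>+x\<in>ball 0 \<rho>. ennreal (w x) \<partial>lebesgue) < top"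
    and f: "f \<in> Lp_space p w" and e: "0 < e"
  shows "\<exists>g R. continuous_on UNIV g \<and> (\<forall>x. R \<le> norm x \<longrightarrow> g x = 0) \<and> Lp_modular p w (\<lambda>x. f x - g x) < ennreal e"
proof -
  have [measurable]: "f \<in> borel_measurable lebesgue" and fin: "Lp_modular p w f < top"
    using f by (auto simp: Lp_space_iff)
  define T where "T m x = (if norm x \<le> real m \<and> norm (f x) \<le> real m then f x else 0)" for m x
  have idm[measurable]: "(\<lambda>x::real^'n. x) \<in> borel_measurable lebesgue"
    by (rule measurable_completion) simp
  have Tm[measurable]: "T m \<in> borel_measurable lebesgue" for m
    unfolding T_def[abs_def] by measurable
  have "(\<lambda>m. Lp_modular p w (\<lambda>x. f x - T m x)) \<longlonglongrightarrow> 0"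
  proof (rule Lp_modular_tendsto_0[OF p, where B = "\<lambda>x. norm (f x)"])
    show "AE x in lebesgue. norm (f x - T i x) \<le> norm (f x)" for i
      by (auto simp: T_def)
    show "AE x in lebesgue. (\<lambda>i. T i x) \<longlonglongrightarrow> f x"
    proof (intro AE_I2 tendsto_eventually)
      fix x
      have "\<forall>\<^sub>F i in sequentially. norm x + norm (f x) \<le> real i"
        using filterlim_real_sequentially unfolding filterlim_at_top by blast
      then show "\<forall>\<^sub>F i in sequentially. T i x = f x"
      proof eventually_elim
        case (elim i)
        then have "norm x \<le> real i" "norm (f x) \<le> real i"
          using norm_ge_zero[of x] norm_ge_zero[of "f x"] by linarith+
        then show ?case by (simp add: T_def)
      qed
    qed
  qed (use fin in \<open>auto simp: Lp_modular_def\<close>)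
  moreover define e' where "e' = e / (2 * 2 powr p)"
  have e': "0 < e'" using e by (simp add: e'_def)
  ultimately have "\<forall>\<^sub>F m in sequentially. Lp_modular p w (\<lambda>x. f x - T m x) < ennreal e'"
    using e' by (intro order_tendstoD(2)) auto
  then obtain m where m: "0 < m" "Lp_modular p w (\<lambda>x. f x - T m x) < ennreal e'"
    using eventually_conj[OF _ eventually_gt_at_top[of 0]] eventually_happens'[OF sequentially_bot] by blast
  obtain g where g: "\<And>i::nat. continuous_on UNIV (g i)" "AE x in lebesgue. (\<lambda>i. g i x) \<longlonglongrightarrow> T m x"
    using AE_limit_of_continuous[OF Tm] by blast
  define cl :: "'k \<Rightarrow> 'k" where "cl y = (real m / max (real m) (norm y)) *\<^sub>R y" for y
  define \<phi> :: "real ^ 'n \<Rightarrow> real" where "\<phi> x = max 0 (min 1 (real m + 1 - norm x))" for x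
  have cl_cont: "continuous_on UNIV cl"
    unfolding cl_def[abs_def] using m(1) by (intro continuous_intros) (auto simp: max_def)
  have cl_norm: "norm (cl y) \<le> m" for y
    using m(1) by (auto simp: cl_def max_def field_simps)
  have \<phi>_cont: "continuous_on UNIV \<phi>"
    unfolding \<phi>_def[abs_def] by (intro continuous_intros)
  define G where "G i x = \<phi> x *\<^sub>R cl (g i x)" for i x
  have G_cont: "continuous_on UNIV (G i)" for i
    unfolding G_def[abs_def]
    by (intro continuous_on_scaleR \<phi>_cont continuous_on_compose2[OF cl_cont g(1)]) auto
  have G_supp: "G i x = 0" if "real m + 1 \<le> norm x" for i x
    using that by (simp add: G_def \<phi>_def)
  have Gm[measurable]: "G i \<in> borel_measurable lebesgue" for i
    using borel_measurable_continuous_onI[OF G_cont[of i]] by (simp add: measurable_completion)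
  have "(\<lambda>i. Lp_modular p w (\<lambda>x. T m x - G i x)) \<longlonglongrightarrow> 0"
  proof (rule Lp_modular_tendsto_0[OF p, where B = "\<lambda>x. 2 * real m * indicator (ball 0 (real m + 1)) x"])
    show "AE x in lebesgue. norm (T m x - G i x) \<le> 2 * real m * indicator (ball 0 (real m + 1)) x" for i
    proof (rule AE_I2)
      fix x :: "real ^ 'n"
      have "norm (T m x) \<le> real m" by (simp add: T_def)
      moreover have "norm (G i x) \<le> real m"
      proof -
        have "norm (G i x) \<le> 1 * norm (cl (g i x))"
          unfolding G_def norm_scaleR by (intro mult_right_mono) (auto simp: \<phi>_def)
        then show ?thesis using cl_norm[of "g i x"] by simp
      qed
      ultimately have "norm (T m x - G i x) \<le> 2 * real m"
        using norm_triangle_ineq4[of "T m x" "G i x"] by linarith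
      moreover have "T m x - G i x = 0" if "x \<notin> ball 0 (real m + 1)"
        using that G_supp[of x i] by (auto simp: T_def)
      ultimately show "norm (T m x - G i x) \<le> 2 * real m * indicator (ball 0 (real m + 1)) x"
        by (auto simp: indicator_def)
    qed
    show "AE x in lebesgue. (\<lambda>i. G i x) \<longlonglongrightarrow> T m x"
      using g(2)
    proof eventually_elim
      fix x assume "(\<lambda>i. g i x) \<longlonglongrightarrow> T m x"
      moreover have "isCont cl (T m x)"
        using cl_cont by (simp add: continuous_on_eq_continuous_at)
      ultimately have "(\<lambda>i. cl (g i x)) \<longlonglongrightarrow> cl (T m x)"
        by (rule isCont_tendsto_compose[rotated])
      then have "(\<lambda>i. G i x) \<longlonglongrightarrow> \<phi> x *\<^sub>R cl (T m x)"
        unfolding G_def by (intro tendsto_intros)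
      also have "cl (T m x) = T m x"
        using m(1) by (auto simp: cl_def T_def max_def)
      also have "\<phi> x *\<^sub>R T m x = T m x"
        by (auto simp: \<phi>_def T_def)
      finally show "(\<lambda>i. G i x) \<longlonglongrightarrow> T m x" .
    qed
    have "(\<integral>\<^sup>+x. ennreal ((2 * real m * indicator (ball 0 (real m + 1)) x) powr p) * ennreal (w x) \<partial>lebesgue) =
        (\<integral>\<^sup>+x. ennreal ((2 * real m) powr p) * (ennreal (w x) * indicator (ball 0 (real m + 1)) x) \<partial>lebesgue)"
      by (intro nn_integral_cong) (auto simp: indicator_def)
    also have "\<dots> = ennreal ((2 * real m) powr p) * (\<integral>\<^sup>+x\<in>ball 0 (real m + 1). ennreal (w x) \<partial>lebesgue)"
      by (rule nn_integral_cmult) measurable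
    also have "\<dots> < top"
      using loc by (simp add: ennreal_mult_less_top)
    finally show "(\<integral>\<^sup>+x. ennreal ((2 * real m * indicator (ball 0 (real m + 1)) x) powr p) * ennreal (w x) \<partial>lebesgue) < top" .
  qed measurable
  then have "\<forall>\<^sub>F i in sequentially. Lp_modular p w (\<lambda>x. T m x - G i x) < ennreal e'"
    using e' by (intro order_tendstoD(2)) auto
  then obtain i where i: "Lp_modular p w (\<lambda>x. T m x - G i x) < ennreal e'"
    using eventually_happens'[OF sequentially_bot] by blast
  have "Lp_modular p w (\<lambda>x. f x - G i x) \<le>
      ennreal (2 powr p) * (Lp_modular p w (\<lambda>x. f x - T m x) + Lp_modular p w (\<lambda>x. T m x - G i x))"
    using p by (intro Lp_modular_triangle) auto
  also have "\<dots> < ennreal (2 powr p) * (ennreal e' + ennreal e')"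
    using m(2) i by (intro ennreal_mult_strict_left_mono add_strict_mono) auto
  also have "\<dots> = ennreal e"
    using e by (simp add: e'_def flip: ennreal_plus ennreal_mult)
  finally show ?thesis using G_cont G_supp by blast
qed

lemma oscillation_le_const:
  fixes f :: "real ^ 'n \<Rightarrow> 'k::{real_normed_field,euclidean_space}"
  assumes r: "0 < r" and c: "0 \<le> c" and bound: "\<And>z. z \<in> ball x r \<Longrightarrow> norm (f x - f z) powr s \<le> c"
  shows "oscillation s f r x \<le> ennreal c"
proof -
  define V where "V = unit_ball_vol (real CARD('n)) * r ^ CARD('n)"
  have V: "0 < V" "\<And>y::real^'n. emeasure lebesgue (ball y r) = ennreal V"
    using r by (auto simp: V_def emeasure_lebesgue_ball simp del: emeasure_completion)
  have "(\<integral>\<^sup>+z\<in>ball x r. ennreal (norm (f x - f z) powr s) \<partial>lebesgue) \<le> (\<integral>\<^sup>+z\<in>ball x r. ennreal c \<partial>lebesgue)"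
    by (intro nn_integral_mono) (use bound in \<open>auto simp: indicator_def intro: ennreal_leI\<close>)
  also have "\<dots> = ennreal c * ennreal V"
    by (simp add: nn_integral_cmult_indicator V del: emeasure_completion)
  finally have "oscillation s f r x \<le> ennreal c * ennreal V / ennreal V"
    unfolding oscillation_def V(2) by (rule divide_right_mono_ennreal)
  also have "\<dots> = ennreal c"
    using V(1) c by (simp add: divide_ennreal flip: ennreal_mult)
  finally show ?thesis .
qed

text \<open>
  By uniform continuity the oscillation is at most \<open>\<eta>\<^sup>s\<close> once \<open>r\<close> is small, and for \<open>r \<le> 1\<close> it vanishes outside
  \<open>B(0, R + 1)\<close>, a ball of finite weight.
\<close>

lemma oscillation_modular_continuous:
  fixes w :: "real ^ 'n \<Rightarrow> real" and g :: "real ^ 'n \<Rightarrow> 'k::{real_normed_field,euclidean_space}"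
  assumes s: "0 < s" and q: "1 < q" and [measurable]: "w \<in> borel_measurable lebesgue"
    and loc: "\<And>\<rho>. (\<integral>\<^sup>+x\<in>ball 0 \<rho>. ennreal (w x) \<partial>lebesgue) < top"
    and g: "continuous_on UNIV g" "\<And>x. R \<le> norm x \<Longrightarrow> g x = 0" and e: "0 < e"
  shows "\<exists>r\<^sub>0>0. \<forall>r. 0 < r \<and> r < r\<^sub>0 \<longrightarrow> oscillation_modular s q w g r < ennreal e"
proof -
  define B where "B = ball (0::real^'n) (R + 1)"
  obtain W where W: "0 \<le> W" "(\<integral>\<^sup>+x\<in>B. ennreal (w x) \<partial>lebesgue) = ennreal W"
    using loc[of "R + 1"] by (cases "(\<integral>\<^sup>+x\<in>B. ennreal (w x) \<partial>lebesgue)") (auto simp: B_def)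
  \<comment> \<open>The denominator is \<open>W + 1\<close> because the weight \<open>W\<close> of \<open>B\<close> is \<open>0\<close> when \<open>B\<close> is empty.\<close>
  define \<eta> where "\<eta> = (e / (W + 1)) powr (1 / (s * q))"
  have \<eta>: "0 < \<eta>" using e W by (simp add: \<eta>_def)
  have "(\<eta> powr s) powr q * W = e / (W + 1) * W"
    using s q e W by (simp add: \<eta>_def powr_powr)
  also have "\<dots> < e" using e W by (simp add: field_simps)
  finally have small: "(\<eta> powr s) powr q * W < e" .
  have "uniformly_continuous_on (cball 0 (R + 1)) g"
    using g(1) by (intro compact_uniformly_continuous) (auto intro: continuous_on_subset)
  then obtain d where d: "0 < d"
    "\<And>x z. x \<in> cball 0 (R + 1) \<Longrightarrow> z \<in> cball 0 (R + 1) \<Longrightarrow> dist z x < d \<Longrightarrow> dist (g z) (g x) < \<eta>"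
    using \<eta> unfolding uniformly_continuous_on_def by meson
  have "oscillation_modular s q w g r < ennreal e" if r: "0 < r" "r < min d 1" for r
  proof -
    have near: "norm (g x - g z) \<le> (if x \<in> B then \<eta> else 0)" if z: "z \<in> ball x r" for x z
    proof (cases "norm x < R \<or> norm z < R")
      case True
      have "dist x z < 1" using z r by simp
      then have "norm x < R + 1" "norm z < R + 1"
        using True norm_triangle_ineq2[of x z] norm_triangle_ineq2[of z x]
        by (auto simp: dist_norm norm_minus_commute)
      moreover have "dist z x < d" using z r by (simp add: dist_commute)
      ultimately show ?thesis
        using d(2)[of x z] by (auto simp: dist_norm B_def norm_minus_commute)
    next
      case False
      then show ?thesis using g(2)[of x] g(2)[of z] \<eta> by auto
    qed
    have "oscillation s g r x \<le> ennreal ((\<eta> powr s) * indicator B x)" for x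
    proof (rule oscillation_le_const[OF r(1)])
      fix z assume "z \<in> ball x r"
      then show "norm (g x - g z) powr s \<le> \<eta> powr s * indicator B x"
        using near[of z x] s powr_mono2[of s "norm (g x - g z)" \<eta>] by (auto split: if_splits)
    qed simp
    then have "ennpowr (oscillation s g r x) q * ennreal (w x) \<le>
        ennpowr (ennreal ((\<eta> powr s) * indicator B x)) q * ennreal (w x)" for x
      using q by (intro mult_right_mono ennpowr_mono) auto
    moreover have "ennpowr (ennreal ((\<eta> powr s) * indicator B x)) q * ennreal (w x) =
        ennreal ((\<eta> powr s) powr q) * (ennreal (w x) * indicator B x)" for x
      by (auto simp: indicator_def ennpowr_ennreal)
    ultimately have "oscillation_modular s q w g r \<le>
        (\<integral>\<^sup>+x. ennreal ((\<eta> powr s) powr q) * (ennreal (w x) * indicator B x) \<partial>lebesgue)"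
      unfolding oscillation_modular_def by (intro nn_integral_mono) metis
    also have "\<dots> = ennreal ((\<eta> powr s) powr q) * (\<integral>\<^sup>+x\<in>B. ennreal (w x) \<partial>lebesgue)"
      unfolding B_def by (rule nn_integral_cmult) measurable
    also have "\<dots> = ennreal ((\<eta> powr s) powr q * W)"
      using W by (simp add: ennreal_mult)
    also have "\<dots> < ennreal e"
      using small e W by (intro ennreal_lessI) auto
    finally show ?thesis .
  qed
  then show ?thesis
    using d(1) by (intro exI[of _ "min d 1"]) auto
qed

lemma oscillation_modular_small:
  fixes w :: "real ^ 'n \<Rightarrow> real" and f :: "real ^ 'n \<Rightarrow> 'k::{real_normed_field,euclidean_space}"
  assumes s: "0 < s" and q: "1 < q" and w: "w \<in> A_class q" and f: "f \<in> Lp_space (s * q) w" and e: "0 < e"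
  shows "\<exists>r\<^sub>0>0. \<forall>r. 0 < r \<and> r < r\<^sub>0 \<longrightarrow> oscillation_modular s q w f r < ennreal e"
proof -
  have wm: "w \<in> borel_measurable lebesgue"
    using A_class_is_weight[OF w] by (auto simp: is_weight_def)
  note loc = A_class_locally_integrable[OF w q]
  obtain C :: real where C: "0 < C" "\<And>f g :: real ^ 'n \<Rightarrow> 'k. \<And>r. f \<in> borel_measurable lebesgue \<Longrightarrow>
      g \<in> borel_measurable lebesgue \<Longrightarrow> 0 < r \<Longrightarrow> oscillation_modular s q w f r \<le>
        ennreal C * (Lp_modular (s * q) w (\<lambda>x. f x - g x) + oscillation_modular s q w g r)"
    using oscillation_modular_perturb[OF s q w, where 'k = 'k] by meson
  define e' where "e' = e / (2 * C)"
  have e': "0 < e'" using e C by (simp add: e'_def)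
  have sq: "0 < s * q" using s q by simp
  obtain g R where g: "continuous_on UNIV g" "\<And>x. R \<le> norm x \<Longrightarrow> g x = 0"
      "Lp_modular (s * q) w (\<lambda>x. f x - g x) < ennreal e'"
    using Lp_approx_continuous[OF sq wm loc f e'] by blast
  obtain r0 where r0: "0 < r0" "\<And>r. 0 < r \<and> r < r0 \<Longrightarrow> oscillation_modular s q w g r < ennreal e'"
    using oscillation_modular_continuous[OF s q wm loc g(1,2) e'] by blast
  have gm: "g \<in> borel_measurable lebesgue"
    using borel_measurable_continuous_onI[OF g(1)] by (simp add: measurable_completion)
  have "oscillation_modular s q w f r < ennreal e" if r: "0 < r \<and> r < r0" for r
  proof -
    have "oscillation_modular s q w f r \<le>
        ennreal C * (Lp_modular (s * q) w (\<lambda>x. f x - g x) + oscillation_modular s q w g r)"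
      using r gm f by (intro C(2)) (auto simp: Lp_space_iff)
    also have "\<dots> < ennreal C * (ennreal e' + ennreal e')"
      using g(3) r0(2)[OF r] C(1) by (intro ennreal_mult_strict_left_mono add_strict_mono) auto
    also have "\<dots> = ennreal e"
      using e C(1) by (simp add: e'_def flip: ennreal_plus ennreal_mult)
    finally show ?thesis .
  qed
  with r0(1) show ?thesis by blast
qed

lemma Lp_modular_tail_small:
  fixes f :: "real ^ 'n \<Rightarrow> 'k::{real_normed_field,euclidean_space}"
  assumes p: "0 < p" and [measurable]: "w \<in> borel_measurable lebesgue" and f: "f \<in> Lp_space p w" and e: "0 < e"
  shows "\<exists>A\<^sub>0. \<forall>A\<ge>A\<^sub>0. Lp_modular p w (\<lambda>x. indicator {x. norm x > A} x *\<^sub>R f x) < ennreal e"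
proof -
  have [measurable]: "f \<in> borel_measurable lebesgue" and fin: "Lp_modular p w f < top"
    using f by (auto simp: Lp_space_iff)
  have idm[measurable]: "(\<lambda>x::real^'n. x) \<in> borel_measurable lebesgue"
    by (rule measurable_completion) simp
  have [measurable]: "(\<lambda>x::real^'n. indicator {x. norm x > A} x :: real) \<in> borel_measurable lebesgue" for A
  proof -
    have "(\<lambda>x::real^'n. if norm x > A then 1 else 0 :: real) \<in> borel_measurable lebesgue"
      by measurable
    then show ?thesis by (simp add: indicator_def[abs_def])
  qed
  have "(\<lambda>i. Lp_modular p w (\<lambda>x. f x - (f x - indicator {x. norm x > real i} x *\<^sub>R f x))) \<longlonglongrightarrow> 0"
  proof (rule Lp_modular_tendsto_0[OF p, where B = "\<lambda>x. norm (f x)"])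
    show "AE x in lebesgue. norm (f x - (f x - indicator {x. norm x > real i} x *\<^sub>R f x)) \<le> norm (f x)" for i
      by (auto simp: indicator_def)
    show "AE x in lebesgue. (\<lambda>i. f x - indicator {x. norm x > real i} x *\<^sub>R f x) \<longlonglongrightarrow> f x"
    proof (intro AE_I2 tendsto_eventually)
      fix x :: "real ^ 'n"
      have "\<forall>\<^sub>F i in sequentially. norm x \<le> real i"
        using filterlim_real_sequentially unfolding filterlim_at_top by blast
      then show "\<forall>\<^sub>F i in sequentially. f x - indicator {x. norm x > real i} x *\<^sub>R f x = f x"
        by eventually_elim (auto simp: indicator_def)
    qed
  qed (use fin in \<open>auto simp: Lp_modular_def\<close>)
  then have "\<forall>\<^sub>F i in sequentially. Lp_modular p w (\<lambda>x. indicator {x. norm x > real i} x *\<^sub>R f x) < ennreal e"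
    using e by (intro order_tendstoD(2)) auto
  then obtain i where i: "Lp_modular p w (\<lambda>x. indicator {x. norm x > real i} x *\<^sub>R f x) < ennreal e"
    using eventually_happens'[OF sequentially_bot] by blast
  have "Lp_modular p w (\<lambda>x. indicator {x. norm x > A} x *\<^sub>R f x) \<le>
      Lp_modular p w (\<lambda>x. indicator {x. norm x > real i} x *\<^sub>R f x)" if "real i \<le> A" for A
    unfolding Lp_modular_def
    by (intro nn_integral_mono mult_right_mono) (use that in \<open>auto simp: indicator_def\<close>)
  with i show ?thesis by (intro exI[of _ "real i"]) (auto intro: le_less_trans)
qed

section \<open>Step functions\<close>

text \<open>
  If \<open>a\<close> exceeded its weighted mean at every point of \<open>E\<close>, then so would the weighted mean itself.
\<close>

lemma point_below_average:
  fixes a :: "'a \<Rightarrow> ennreal" and w :: "'a \<Rightarrow> real"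
  assumes [measurable]: "a \<in> borel_measurable M" "w \<in> borel_measurable M" "E \<in> sets M"
    and w: "AE x in M. 0 < w x"
    and pos: "(\<integral>\<^sup>+x\<in>E. ennreal (w x) \<partial>M) \<noteq> 0" and fin: "(\<integral>\<^sup>+x\<in>E. ennreal (w x) \<partial>M) < top"
  shows "\<exists>u\<in>E. a u * (\<integral>\<^sup>+x\<in>E. ennreal (w x) \<partial>M) \<le> (\<integral>\<^sup>+x\<in>E. a x * ennreal (w x) \<partial>M)"
proof (rule ccontr)
  define m where "m = (\<integral>\<^sup>+x\<in>E. ennreal (w x) \<partial>M)"
  define I where "I = (\<integral>\<^sup>+x\<in>E. a x * ennreal (w x) \<partial>M)"
  assume "\<not> ?thesis"
  then have I: "I < a u * m" if "u \<in> E" for u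
    using that by (auto simp: m_def I_def not_le)
  have "E \<noteq> {}" using pos by auto
  then have I_fin: "I < top" using I by (metis ex_in_conv less_top top.not_eq_extremum order_less_le_trans top_greatest)
  have m: "m \<noteq> 0" "m < top" using pos fin by (auto simp: m_def)
  define c where "c = I / m"
  have cm: "c * m = I"
    using m by (simp add: c_def ennreal_divide_times ennreal_divide_self)
  have above: "c < a u" if "u \<in> E" for u
    using I[OF that] cm by (metis linorder_not_less mult_right_mono zero_le)
  have c_int: "(\<integral>\<^sup>+x. c * (ennreal (w x) * indicator E x) \<partial>M) = I"
    using cm by (subst nn_integral_cmult) (auto simp: m_def)
  have "(\<integral>\<^sup>+x. c * (ennreal (w x) * indicator E x) \<partial>M) < (\<integral>\<^sup>+x. a x * (ennreal (w x) * indicator E x) \<partial>M)"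
  proof (rule nn_integral_less)
    show "(\<integral>\<^sup>+x. c * (ennreal (w x) * indicator E x) \<partial>M) \<noteq> \<infinity>"
      unfolding c_int using I_fin by simp
    show "AE x in M. c * (ennreal (w x) * indicator E x) \<le> a x * (ennreal (w x) * indicator E x)"
      by (intro AE_I2) (auto simp: indicator_def intro!: mult_right_mono less_imp_le[OF above])
    show "\<not> (AE x in M. a x * (ennreal (w x) * indicator E x) \<le> c * (ennreal (w x) * indicator E x))"
    proof
      assume "AE x in M. a x * (ennreal (w x) * indicator E x) \<le> c * (ennreal (w x) * indicator E x)"
      with w have "AE x in M. ennreal (w x) * indicator E x = 0"
      proof eventually_elim
        fix x assume wx: "0 < w x" and le: "a x * (ennreal (w x) * indicator E x) \<le> c * (ennreal (w x) * indicator E x)"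
        have "x \<notin> E"
        proof
          assume x: "x \<in> E"
          then have "c * ennreal (w x) < a x * ennreal (w x)"
            using above[OF x] wx by (intro ennreal_mult_strict_right_mono) auto
          then show False using le x by simp
        qed
        then show "ennreal (w x) * indicator E x = 0" by simp
      qed
      then have "m = 0" unfolding m_def by (subst nn_integral_0_iff_AE) auto
      then show False using m by simp
    qed
  qed measurable
  then show False by (simp add: c_int I_def mult.assoc)
qed

text \<open>
  The quasi-triangle inequality through an intermediate value \<open>f(z)\<close> is averaged over \<open>z \<in> B(c, \<rho>)\<close>. This ball lies in
  \<open>B(x, 2 \<rho>)\<close> and in \<open>B(u, 2 \<rho>)\<close>, whose volumes are larger by the factor \<open>2\<^sup>n\<close>.
\<close>

lemma deviation_le_oscillation:
  fixes f :: "real ^ 'n \<Rightarrow> 'k::{real_normed_field,euclidean_space}"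
  assumes s: "0 < s" and [measurable]: "f \<in> borel_measurable lebesgue"
    and \<rho>: "0 < \<rho>" and x: "x \<in> ball c \<rho>" and u: "u \<in> ball c \<rho>"
  shows "ennreal (norm (f x - f u) powr s) \<le>
    ennreal (2 powr s * 2 ^ CARD('n)) * (oscillation s f (2 * \<rho>) x + oscillation s f (2 * \<rho>) u)"
proof -
  define V where "V = unit_ball_vol (real CARD('n)) * \<rho> ^ CARD('n)"
  have V: "0 < V" "\<And>y::real^'n. emeasure lebesgue (ball y \<rho>) = ennreal V"
    using \<rho> by (auto simp: V_def emeasure_lebesgue_ball simp del: emeasure_completion)
  have V2: "emeasure lebesgue (ball (0::real^'n) (2 * \<rho>)) = ennreal (2 ^ CARD('n) * V)"
    using \<rho> emeasure_lebesgue_ball[of "2 * \<rho>" "0::real^'n"] by (simp add: V_def power_mult_distrib mult_ac)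
  have osc: "(\<integral>\<^sup>+z\<in>ball c \<rho>. ennreal (norm (f y - f z) powr s) \<partial>lebesgue) \<le>
      oscillation s f (2 * \<rho>) y * ennreal (2 ^ CARD('n) * V)" if y: "y \<in> ball c \<rho>" for y
  proof -
    have "ball c \<rho> \<subseteq> ball y (2 * \<rho>)"
    proof
      fix z assume "z \<in> ball c \<rho>"
      with y show "z \<in> ball y (2 * \<rho>)"
        using dist_triangle[of y z c] by (simp add: dist_commute)
    qed
    then have "(\<integral>\<^sup>+z\<in>ball c \<rho>. ennreal (norm (f y - f z) powr s) \<partial>lebesgue) \<le>
        (\<integral>\<^sup>+z\<in>ball y (2 * \<rho>). ennreal (norm (f y - f z) powr s) \<partial>lebesgue)" (is "_ \<le> ?I")
      by (rule set_nn_integral_mono_set)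
    also have "?I = ?I * (ennreal (2 ^ CARD('n) * V) / ennreal (2 ^ CARD('n) * V))"
      using V(1) by (simp add: ennreal_divide_self)
    also have "\<dots> = oscillation s f (2 * \<rho>) y * ennreal (2 ^ CARD('n) * V)"
      unfolding oscillation_def V2 by (simp only: ennreal_divide_times)
    finally show ?thesis .
  qed
  have "ennreal (norm (f x - f u) powr s) * ennreal V =
      (\<integral>\<^sup>+z\<in>ball c \<rho>. ennreal (norm (f x - f u) powr s) \<partial>lebesgue)"
    by (simp add: nn_integral_cmult_indicator V del: emeasure_completion)
  also have "\<dots> \<le> (\<integral>\<^sup>+z. ennreal (2 powr s) * (ennreal (norm (f x - f z) powr s) * indicator (ball c \<rho>) z +
      ennreal (norm (f u - f z) powr s) * indicator (ball c \<rho>) z) \<partial>lebesgue)"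
  proof (rule nn_integral_mono)
    fix z
    have "norm (f x - f u) powr s \<le> 2 powr s * (norm (f x - f z) powr s + norm (f u - f z) powr s)"
      using s norm_add_powr_le[of s "f x - f z" "f z - f u"] by (simp add: norm_minus_commute)
    then have "ennreal (norm (f x - f u) powr s) \<le>
        ennreal (2 powr s) * (ennreal (norm (f x - f z) powr s) + ennreal (norm (f u - f z) powr s))"
      by (simp add: ennreal_leI flip: ennreal_plus ennreal_mult)
    then show "ennreal (norm (f x - f u) powr s) * indicator (ball c \<rho>) z \<le>
        ennreal (2 powr s) * (ennreal (norm (f x - f z) powr s) * indicator (ball c \<rho>) z +
          ennreal (norm (f u - f z) powr s) * indicator (ball c \<rho>) z)"
      by (auto simp: indicator_def)
  qed
  also have "\<dots> = ennreal (2 powr s) * ((\<integral>\<^sup>+z\<in>ball c \<rho>. ennreal (norm (f x - f z) powr s) \<partial>lebesgue) +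
      (\<integral>\<^sup>+z\<in>ball c \<rho>. ennreal (norm (f u - f z) powr s) \<partial>lebesgue))"
    by (subst nn_integral_cmult) (auto simp: nn_integral_add)
  also have "\<dots> \<le> ennreal (2 powr s) * (oscillation s f (2 * \<rho>) x * ennreal (2 ^ CARD('n) * V) +
      oscillation s f (2 * \<rho>) u * ennreal (2 ^ CARD('n) * V))"
    by (intro mult_left_mono add_mono osc x u) simp
  also have "\<dots> = (ennreal (2 powr s * 2 ^ CARD('n)) * (oscillation s f (2 * \<rho>) x + oscillation s f (2 * \<rho>) u)) * ennreal V"
    using V(1) by (simp add: ennreal_mult algebra_simps)
  finally have le: "ennreal (norm (f x - f u) powr s) * ennreal V \<le>
    (ennreal (2 powr s * 2 ^ CARD('n)) * (oscillation s f (2 * \<rho>) x + oscillation s f (2 * \<rho>) u)) * ennreal V" .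
  have cancel: "X * ennreal V / ennreal V = X" for X
  proof -
    have "ennreal V / ennreal V = 1" using V(1) by (simp add: ennreal_divide_self)
    then show ?thesis by (simp flip: ennreal_times_divide)
  qed
  from divide_right_mono_ennreal[OF le, of "ennreal V"] show ?thesis
    unfolding cancel .
qed

text \<open>
  The constant is a value \<open>f(u)\<close> at a point \<open>u\<close> where the \<open>q\<close>-th power of the oscillation does not exceed its
  weighted mean over \<open>E\<close>. Only the ball around \<open>E\<close> enters the bound, hence \<open>E\<close> may be an arbitrarily small part of it.
\<close>

lemma constant_approximation:
  fixes w :: "real ^ 'n \<Rightarrow> real"
  assumes s: "0 < s" and q: "1 < q" and w: "is_weight w"
  shows "\<exists>D::real>0. \<forall>f::real ^ 'n \<Rightarrow> 'k::{real_normed_field,euclidean_space}\<in>borel_measurable lebesgue.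
    \<forall>\<rho>>0. \<forall>c. \<forall>E\<in>sets lebesgue. E \<subseteq> ball c \<rho> \<longrightarrow> (\<integral>\<^sup>+x\<in>E. ennreal (w x) \<partial>lebesgue) < top \<longrightarrow>
      (\<exists>k. ((\<integral>\<^sup>+x\<in>E. ennreal (w x) \<partial>lebesgue) = 0 \<longrightarrow> k = 0) \<and>
        (\<integral>\<^sup>+x\<in>E. ennreal (norm (f x - k) powr (s * q)) * ennreal (w x) \<partial>lebesgue) \<le>
        ennreal D * (\<integral>\<^sup>+x\<in>E. ennpowr (oscillation s f (2 * \<rho>) x) q * ennreal (w x) \<partial>lebesgue))"
proof -
  have [measurable]: "w \<in> borel_measurable lebesgue" and pos: "AE x in lebesgue. 0 < w x"
    using w by (auto simp: is_weight_def)
  define D where "D = (2 powr s * 2 ^ CARD('n)) powr q * 2 powr q"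
  have D: "0 < D" by (simp add: D_def)
  show ?thesis
  proof (intro exI[of _ "2 * D"] conjI ballI allI impI)
    show "0 < 2 * D" using D by simp
    fix f :: "real ^ 'n \<Rightarrow> 'k" and \<rho> :: real and c E
    assume [measurable]: "f \<in> borel_measurable lebesgue" "E \<in> sets lebesgue"
      and \<rho>: "0 < \<rho>" and E: "E \<subseteq> ball c \<rho>" and fin: "(\<integral>\<^sup>+x\<in>E. ennreal (w x) \<partial>lebesgue) < top"
    note [measurable] = oscillation_measurable[of f]
    define a where "a x = ennpowr (oscillation s f (2 * \<rho>) x) q" for x
    have [measurable]: "a \<in> borel_measurable lebesgue"
      unfolding a_def[abs_def] by measurable
    define W where "W = (\<integral>\<^sup>+x\<in>E. ennreal (w x) \<partial>lebesgue)"
    show "\<exists>k. ((\<integral>\<^sup>+x\<in>E. ennreal (w x) \<partial>lebesgue) = 0 \<longrightarrow> k = 0) \<and>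
        (\<integral>\<^sup>+x\<in>E. ennreal (norm (f x - k) powr (s * q)) * ennreal (w x) \<partial>lebesgue) \<le>
        ennreal (2 * D) * (\<integral>\<^sup>+x\<in>E. ennpowr (oscillation s f (2 * \<rho>) x) q * ennreal (w x) \<partial>lebesgue)"
    proof (cases "W = 0")
      case True
      then have "AE x in lebesgue. ennreal (w x) * indicator E x = 0"
        unfolding W_def by (subst (asm) nn_integral_0_iff_AE) auto
      then have "AE x in lebesgue. ennreal (norm (f x - 0) powr (s * q)) * ennreal (w x) * indicator E x = 0"
        by eventually_elim (simp add: mult.assoc)
      then have "(\<integral>\<^sup>+x\<in>E. ennreal (norm (f x - 0) powr (s * q)) * ennreal (w x) \<partial>lebesgue) = 0"
        by (subst nn_integral_0_iff_AE) auto
      then show ?thesis by (intro exI[of _ 0]) simp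
    next
      case False
      obtain u where u: "u \<in> E" "a u * W \<le> (\<integral>\<^sup>+x\<in>E. a x * ennreal (w x) \<partial>lebesgue)"
        using point_below_average[of a lebesgue w E] pos False fin unfolding W_def by auto
      have "ennreal (norm (f x - f u) powr (s * q)) \<le> ennreal D * (a x + a u)" if x: "x \<in> E" for x
      proof -
        have "ennreal (norm (f x - f u) powr (s * q)) = ennpowr (ennreal (norm (f x - f u) powr s)) q"
          by (simp add: ennpowr_ennreal powr_powr)
        also have "\<dots> \<le> ennpowr (ennreal (2 powr s * 2 ^ CARD('n)) *
            (oscillation s f (2 * \<rho>) x + oscillation s f (2 * \<rho>) u)) q"
          using q E x u(1) by (intro ennpowr_mono deviation_le_oscillation[where c = c] s \<rho>) auto
        also have "\<dots> = ennreal ((2 powr s * 2 ^ CARD('n)) powr q) *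
            ennpowr (oscillation s f (2 * \<rho>) x + oscillation s f (2 * \<rho>) u) q"
          by (subst ennpowr_mult) (simp add: ennpowr_ennreal)
        also have "\<dots> \<le> ennreal ((2 powr s * 2 ^ CARD('n)) powr q) * (ennreal (2 powr q) * (a x + a u))"
          unfolding a_def using q by (intro mult_left_mono ennpowr_sum_le) auto
        also have "\<dots> = ennreal D * (a x + a u)"
          by (simp add: D_def ennreal_mult mult.assoc)
        finally show ?thesis .
      qed
      then have "ennreal (norm (f x - f u) powr (s * q)) * (ennreal (w x) * indicator E x) \<le>
          (ennreal D * (a x + a u)) * (ennreal (w x) * indicator E x)" for x
        by (cases "x \<in> E") (auto intro: mult_right_mono)
      then have "(\<integral>\<^sup>+x\<in>E. ennreal (norm (f x - f u) powr (s * q)) * ennreal (w x) \<partial>lebesgue) \<le>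
          (\<integral>\<^sup>+x. ennreal D * (a x * ennreal (w x) * indicator E x + a u * (ennreal (w x) * indicator E x)) \<partial>lebesgue)"
        by (intro nn_integral_mono) (simp add: algebra_simps)
      also have "\<dots> = ennreal D * ((\<integral>\<^sup>+x\<in>E. a x * ennreal (w x) \<partial>lebesgue) + a u * W)"
        unfolding W_def by (subst nn_integral_cmult) (auto simp: nn_integral_add nn_integral_cmult)
      also have "\<dots> \<le> ennreal D * ((\<integral>\<^sup>+x\<in>E. a x * ennreal (w x) \<partial>lebesgue) + (\<integral>\<^sup>+x\<in>E. a x * ennreal (w x) \<partial>lebesgue))"
        by (intro mult_left_mono add_left_mono u(2)) simp
      also have "\<dots> = ennreal (2 * D) * (\<integral>\<^sup>+x\<in>E. a x * ennreal (w x) \<partial>lebesgue)"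
        using D by (simp add: ennreal_mult mult_2[symmetric] mult.left_commute mult.assoc)
      finally show ?thesis
        using False by (intro exI[of _ "f u"]) (simp add: a_def W_def)
    qed
  qed
qed

definition step_function :: "(nat \<Rightarrow> 'a set) \<Rightarrow> nat \<Rightarrow> (nat \<Rightarrow> 'b) \<Rightarrow> 'a \<Rightarrow> 'b::real_vector" where
  "step_function E m k x = (\<Sum>i<m. indicator (E i) x *\<^sub>R k i)"

lemma step_function_eq:
  assumes "disjoint_family E" "i < m" "x \<in> E i"
  shows "step_function E m k x = k i"
proof -
  have "indicator (E j) x *\<^sub>R k j = (if j = i then k i else 0)" for j
    using assms(1,3) by (auto simp: disjoint_family_on_def indicator_def)
  then show ?thesis using assms(2) by (simp add: step_function_def)
qed

lemma step_function_diff: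
  "step_function E m k x - step_function E m k' x = step_function E m (\<lambda>i. k i - k' i) x"
  by (simp add: step_function_def sum_subtractf scaleR_diff_right)

lemma step_function_measurable:
  fixes k :: "nat \<Rightarrow> 'b::euclidean_space"
  assumes [measurable]: "\<And>i. E i \<in> sets M"
  shows "step_function E m k \<in> borel_measurable M"
  unfolding step_function_def[abs_def] by measurable

lemma Lp_modular_step_function:
  fixes w :: "real ^ 'n \<Rightarrow> real" and k :: "nat \<Rightarrow> 'k::{real_normed_field,euclidean_space}"
  assumes [measurable]: "w \<in> borel_measurable lebesgue" "\<And>i. E i \<in> sets lebesgue" and E: "disjoint_family E"
  shows "Lp_modular p w (step_function E m k) =
    (\<Sum>i<m. ennreal (norm (k i) powr p) * (\<integral>\<^sup>+x\<in>E i. ennreal (w x) \<partial>lebesgue))"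
proof -
  have "ennreal (norm (step_function E m k x) powr p) * ennreal (w x) =
      (\<Sum>i<m. ennreal (norm (k i) powr p) * (ennreal (w x) * indicator (E i) x))" for x
  proof (cases "\<exists>i<m. x \<in> E i")
    case True
    then obtain i where i: "i < m" "x \<in> E i" by blast
    have "ennreal (norm (k j) powr p) * (ennreal (w x) * indicator (E j) x) =
        (if j = i then ennreal (norm (k i) powr p) * ennreal (w x) else 0)" for j
      using E i(2) by (auto simp: disjoint_family_on_def indicator_def)
    then show ?thesis using i by (simp add: step_function_eq[OF E i])
  qed (auto simp: step_function_def)
  then show ?thesis
    unfolding Lp_modular_def by (simp add: nn_integral_sum nn_integral_cmult)
qed

text \<open>
  On a cell of positive weight the modular bounds the coefficient, so all coefficients lie in one ball of the
  finite-dimensional scalar field, and a finite net of this ball yields a finite net of step functions. On a cell of weight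
  \<open>0\<close> the modular says nothing about the coefficient; it is normalized to \<open>0\<close>.
\<close>

lemma bounded_step_functions_totally_bounded:
  fixes w :: "real ^ 'n \<Rightarrow> real"
  assumes p: "0 < p" and [measurable]: "w \<in> borel_measurable lebesgue" "\<And>i. E i \<in> sets lebesgue"
    and E: "disjoint_family E" and fin: "\<And>i. (\<integral>\<^sup>+x\<in>E i. ennreal (w x) \<partial>lebesgue) < top"
    and M: "0 \<le> M" and e: "0 < e"
  shows "\<exists>F. finite F \<and> F \<subseteq> Lp_space p w \<and>
    (\<forall>k::nat \<Rightarrow> 'k::{real_normed_field,euclidean_space}.
      (\<forall>i<m. (\<integral>\<^sup>+x\<in>E i. ennreal (w x) \<partial>lebesgue) = 0 \<longrightarrow> k i = 0) \<longrightarrow>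
      Lp_modular p w (step_function E m k) \<le> ennreal M \<longrightarrow>
      (\<exists>g\<in>F. Lp_modular p w (\<lambda>x. step_function E m k x - g x) < ennreal e))"
proof -
  define v where "v i = enn2real (\<integral>\<^sup>+x\<in>E i. ennreal (w x) \<partial>lebesgue)" for i
  have v: "0 \<le> v i" "(\<integral>\<^sup>+x\<in>E i. ennreal (w x) \<partial>lebesgue) = ennreal (v i)" for i
    using fin[of i] by (auto simp: v_def)
  have mod: "Lp_modular p w (step_function E m k) = ennreal (\<Sum>i<m. norm (k i) powr p * v i)" for k :: "nat \<Rightarrow> 'k"
    using v(1) by (simp add: Lp_modular_step_function[OF assms(2,3) E] v(2) sum_ennreal flip: ennreal_mult)
  \<comment> \<open>For a cell with \<open>v i = 0\<close> the summand \<open>(M / v i) powr (1 / p)\<close> of \<open>R\<close> is \<open>0\<close>, as is the coefficient.\<close>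
  define R where "R = (\<Sum>i<m. (M / v i) powr (1 / p))"
  have R: "0 \<le> R" by (simp add: R_def sum_nonneg)
  define \<eta> where "\<eta> = (e / ((\<Sum>i<m. v i) + 1)) powr (1 / p)"
  have sv: "0 \<le> (\<Sum>i<m. v i)" by (intro sum_nonneg v)
  have \<eta>: "0 < \<eta>" "\<eta> powr p * (\<Sum>i<m. v i) < e"
    using e p sv by (auto simp: \<eta>_def powr_powr field_simps add_pos_nonneg)
  obtain N :: "'k set" where N: "finite N" "cball 0 R \<subseteq> (\<Union>y\<in>N. ball y \<eta>)"
    using compact_eq_totally_bounded[THEN iffD1, OF compact_cball[of "0::'k" R]] \<eta>(1) by blast
  define F where "F = step_function E m ` ({..<m} \<rightarrow>\<^sub>E N)"
  show ?thesis
  proof (intro exI conjI allI impI)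
    show "finite F" unfolding F_def using N(1) by (intro finite_imageI finite_PiE) auto
    show "F \<subseteq> Lp_space p w"
    proof
      fix g assume "g \<in> F"
      then obtain k where g: "g = step_function E m k" unfolding F_def by blast
      show "g \<in> Lp_space p w"
        unfolding Lp_space_iff g mod using step_function_measurable[OF assms(3)] by simp
    qed
    fix k :: "nat \<Rightarrow> 'k"
    assume k0: "\<forall>i<m. (\<integral>\<^sup>+x\<in>E i. ennreal (w x) \<partial>lebesgue) = 0 \<longrightarrow> k i = 0"
      and kM: "Lp_modular p w (step_function E m k) \<le> ennreal M"
    have bound: "norm (k i) \<le> R" if i: "i < m" for i
    proof (cases "v i = 0")
      case True
      then show ?thesis using k0 i R by (simp add: v(2))
    next
      case False
      then have vi: "0 < v i" using v(1)[of i] by simp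
      have "norm (k i) powr p * v i \<le> (\<Sum>i<m. norm (k i) powr p * v i)"
        using i v(1) by (intro member_le_sum) auto
      also have "\<dots> \<le> M" using kM M by (simp add: mod)
      finally have "norm (k i) powr p \<le> M / v i" using vi by (simp add: field_simps)
      then have "(norm (k i) powr p) powr (1 / p) \<le> (M / v i) powr (1 / p)"
        using p by (intro powr_mono2) auto
      also have "\<dots> \<le> R"
        unfolding R_def using i by (intro member_le_sum) auto
      finally show ?thesis using p by (simp add: powr_powr)
    qed
    have "\<forall>i\<in>{..<m}. \<exists>y\<in>N. dist (k i) y < \<eta>"
      using N(2) bound by (fastforce simp: dist_commute)
    then obtain k' where k': "\<And>i. i < m \<Longrightarrow> k' i \<in> N \<and> dist (k i) (k' i) < \<eta>"
      by (metis lessThan_iff)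
    define g where "g = step_function E m (restrict k' {..<m})"
    have "g \<in> F" unfolding F_def g_def using k' by (intro imageI iffD2[OF restrict_PiE_iff]) auto
    moreover have "Lp_modular p w (\<lambda>x. step_function E m k x - g x) < ennreal e"
    proof -
      have "Lp_modular p w (\<lambda>x. step_function E m k x - g x) =
          ennreal (\<Sum>i<m. norm (k i - k' i) powr p * v i)"
        unfolding g_def step_function_diff mod[of "\<lambda>i. k i - restrict k' {..<m} i", unfolded eta_contract_eq] by simp
      also have "\<dots> \<le> ennreal (\<Sum>i<m. \<eta> powr p * v i)"
        using p k' v(1)
        by (intro ennreal_leI sum_mono mult_right_mono powr_mono2) (auto simp: dist_norm less_imp_le)
      also have "\<dots> < ennreal e" using \<eta>(2) e by (intro ennreal_lessI) (auto simp: sum_distrib_left)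
      finally show ?thesis .
    qed
    ultimately show "\<exists>g\<in>F. Lp_modular p w (\<lambda>x. step_function E m k x - g x) < ennreal e" by blast
  qed
qed

text \<open>
  The cells come from a finite cover of the ball of radius \<open>A\<close> by balls of radius \<open>\<rho>\<close> and are the same for all \<open>f\<close>.
  Outside of their union the step function vanishes and \<open>f\<close> agrees with its tail.
\<close>

lemma step_function_approximation:
  fixes w :: "real ^ 'n \<Rightarrow> real"
  assumes s: "0 < s" and q: "1 < q" and w: "is_weight w"
    and loc: "\<And>z \<rho>. (\<integral>\<^sup>+x\<in>ball z \<rho>. ennreal (w x) \<partial>lebesgue) < top"
  shows "\<exists>D::real>0. \<forall>\<rho>>0. \<forall>A. \<exists>E m. (\<forall>i. E i \<in> sets lebesgue) \<and> disjoint_family E \<and>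
    (\<forall>i. (\<integral>\<^sup>+x\<in>E i. ennreal (w x) \<partial>lebesgue) < top) \<and>
    (\<forall>f::real ^ 'n \<Rightarrow> 'k::{real_normed_field,euclidean_space}\<in>borel_measurable lebesgue.
      \<exists>k. (\<forall>i<m. (\<integral>\<^sup>+x\<in>E i. ennreal (w x) \<partial>lebesgue) = 0 \<longrightarrow> k i = 0) \<and>
        Lp_modular (s * q) w (\<lambda>x. f x - step_function E m k x) \<le>
        ennreal D * oscillation_modular s q w f (2 * \<rho>) +
        Lp_modular (s * q) w (\<lambda>x. indicator {x. norm x > A} x *\<^sub>R f x))"
proof -
  have [measurable]: "w \<in> borel_measurable lebesgue"
    using w by (auto simp: is_weight_def)
  obtain D :: real where D: "0 < D"
    "\<And>(f::real ^ 'n \<Rightarrow> 'k) \<rho> c E. f \<in> borel_measurable lebesgue \<Longrightarrow> 0 < \<rho> \<Longrightarrow> E \<in> sets lebesgue \<Longrightarrow> E \<subseteq> ball c \<rho> \<Longrightarrow>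
      (\<integral>\<^sup>+x\<in>E. ennreal (w x) \<partial>lebesgue) < top \<Longrightarrow>
      \<exists>k. ((\<integral>\<^sup>+x\<in>E. ennreal (w x) \<partial>lebesgue) = 0 \<longrightarrow> k = 0) \<and>
        (\<integral>\<^sup>+x\<in>E. ennreal (norm (f x - k) powr (s * q)) * ennreal (w x) \<partial>lebesgue) \<le>
        ennreal D * (\<integral>\<^sup>+x\<in>E. ennpowr (oscillation s f (2 * \<rho>) x) q * ennreal (w x) \<partial>lebesgue)"
    using constant_approximation[OF s q w, where 'k = 'k] by meson
  show ?thesis
  proof (intro exI[of _ D] conjI allI impI D(1))
    fix \<rho> A :: real assume \<rho>: "0 < \<rho>"
    obtain N :: "(real ^ 'n) set" where N: "finite N" "cball 0 A \<subseteq> (\<Union>y\<in>N. ball y \<rho>)"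
      using compact_eq_totally_bounded[THEN iffD1, OF compact_cball[of "0::real^'n" A]] \<rho> by blast
    obtain ys where ys: "set ys = N" using finite_list[OF N(1)] by blast
    define E where "E = disjointed (\<lambda>j. ball (ys ! j) \<rho>)"
    define m where "m = length ys"
    have Es[measurable]: "E i \<in> sets lebesgue" for i
    proof -
      have "range (\<lambda>j. ball (ys ! j) \<rho>) \<subseteq> sets lebesgue" by auto
      from sets.range_disjointed_sets[OF this] show ?thesis unfolding E_def by auto
    qed
    have Ed: "disjoint_family E" unfolding E_def by (rule disjoint_family_disjointed)
    have Eb: "E i \<subseteq> ball (ys ! i) \<rho>" for i unfolding E_def by (rule disjointed_subset)
    have cover: "cball 0 A \<subseteq> (\<Union>i<m. E i)"
    proof -
      have "(\<Union>y\<in>N. ball y \<rho>) = (\<Union>i\<in>{0..<m}. ball (ys ! i) \<rho>)"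
      proof -
        have "N = (!) ys ` {0..<m}" using nth_image[of m ys] by (simp add: ys m_def)
        then show ?thesis by simp
      qed
      also have "\<dots> = (\<Union>i\<in>{0..<m}. E i)"
        unfolding E_def by (rule finite_UN_disjointed_eq[symmetric])
      finally show ?thesis using N(2) by (simp add: atLeast0LessThan)
    qed
    have Ew: "(\<integral>\<^sup>+x\<in>E i. ennreal (w x) \<partial>lebesgue) < top" for i
      using set_nn_integral_mono_set[OF Eb[of i], of lebesgue "\<lambda>x. ennreal (w x)"] loc
      by (rule le_less_trans)
    have "\<exists>k. (\<forall>i<m. (\<integral>\<^sup>+x\<in>E i. ennreal (w x) \<partial>lebesgue) = 0 \<longrightarrow> k i = 0) \<and>
        Lp_modular (s * q) w (\<lambda>x. f x - step_function E m k x) \<le>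
        ennreal D * oscillation_modular s q w f (2 * \<rho>) +
        Lp_modular (s * q) w (\<lambda>x. indicator {x. norm x > A} x *\<^sub>R f x)"
      if fm [measurable]: "f \<in> borel_measurable lebesgue" for f :: "real ^ 'n \<Rightarrow> 'k"
    proof -
      note [measurable] = oscillation_measurable[of f]
      define a where "a x = ennpowr (oscillation s f (2 * \<rho>) x) q * ennreal (w x)" for x
      have [measurable]: "a \<in> borel_measurable lebesgue"
        unfolding a_def[abs_def] by measurable
      have [measurable]: "(\<lambda>x::real^'n. indicator {x. norm x > A} x :: real) \<in> borel_measurable lebesgue"
        by (rule borel_measurable_indicator) (simp add: open_Collect_less continuous_on_norm)
      have "\<forall>i. \<exists>k. ((\<integral>\<^sup>+x\<in>E i. ennreal (w x) \<partial>lebesgue) = 0 \<longrightarrow> k = 0) \<and>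
        (\<integral>\<^sup>+x\<in>E i. ennreal (norm (f x - k) powr (s * q)) * ennreal (w x) \<partial>lebesgue) \<le>
        ennreal D * (\<integral>\<^sup>+x\<in>E i. a x \<partial>lebesgue)"
        using D(2)[OF fm \<rho> Es Eb Ew] unfolding a_def by blast
      from choice[OF this] obtain k where k: "\<forall>i. ((\<integral>\<^sup>+x\<in>E i. ennreal (w x) \<partial>lebesgue) = 0 \<longrightarrow> k i = 0) \<and>
        (\<integral>\<^sup>+x\<in>E i. ennreal (norm (f x - k i) powr (s * q)) * ennreal (w x) \<partial>lebesgue) \<le>
        ennreal D * (\<integral>\<^sup>+x\<in>E i. a x \<partial>lebesgue)" ..
      have pt: "ennreal (norm (f x - step_function E m k x) powr (s * q)) * ennreal (w x) \<le>
          (\<Sum>i<m. ennreal (norm (f x - k i) powr (s * q)) * ennreal (w x) * indicator (E i) x) +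
          ennreal (norm (indicator {x. norm x > A} x *\<^sub>R f x) powr (s * q)) * ennreal (w x)" for x
      proof (cases "\<exists>i<m. x \<in> E i")
        case True
        then obtain i where i: "i < m" "x \<in> E i" by blast
        have "ennreal (norm (f x - step_function E m k x) powr (s * q)) * ennreal (w x) =
            ennreal (norm (f x - k i) powr (s * q)) * ennreal (w x) * indicator (E i) x"
          using i by (simp add: step_function_eq[OF Ed i])
        also have "\<dots> \<le> (\<Sum>i<m. ennreal (norm (f x - k i) powr (s * q)) * ennreal (w x) * indicator (E i) x)"
          using i(1) by (intro member_le_sum) auto
        finally show ?thesis by (simp add: add_increasing2)
      next
        case False
        then have "x \<notin> cball 0 A" using cover by auto
        moreover have "step_function E m k x = 0" using False by (auto simp: step_function_def)
        ultimately show ?thesis by (simp add: add_increasing)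
      qed
      have "(\<Sum>i<m. \<integral>\<^sup>+x\<in>E i. ennreal (norm (f x - k i) powr (s * q)) * ennreal (w x) \<partial>lebesgue) \<le>
          (\<Sum>i<m. ennreal D * (\<integral>\<^sup>+x\<in>E i. a x \<partial>lebesgue))"
        using k by (intro sum_mono) auto
      also have "\<dots> = ennreal D * (\<integral>\<^sup>+x\<in>(\<Union>i<m. E i). a x \<partial>lebesgue)"
      proof -
        have "a x * indicator (\<Union>i<m. E i) x = (\<Sum>i<m. a x * indicator (E i) x)" for x
        proof -
          have "disjoint_family_on E {..<m}" using Ed by (auto simp: disjoint_family_on_def)
          then have "(indicator (\<Union>i<m. E i) x :: ennreal) = (\<Sum>i<m. indicator (E i) x)"
            by (intro indicator_UN_disjoint) auto
          then show ?thesis by (simp only: sum_distrib_left)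
        qed
        then have "(\<integral>\<^sup>+x\<in>(\<Union>i<m. E i). a x \<partial>lebesgue) = (\<integral>\<^sup>+x. (\<Sum>i<m. a x * indicator (E i) x) \<partial>lebesgue)"
          by (simp only:)
        also have "\<dots> = (\<Sum>i<m. \<integral>\<^sup>+x\<in>E i. a x \<partial>lebesgue)"
          by (rule nn_integral_sum) measurable
        finally show ?thesis by (simp only: sum_distrib_left)
      qed
      also have "\<dots> \<le> ennreal D * oscillation_modular s q w f (2 * \<rho>)"
        unfolding oscillation_modular_def a_def
        by (intro mult_left_mono nn_integral_mono) (auto simp: indicator_def)
      finally have cells: "(\<Sum>i<m. \<integral>\<^sup>+x\<in>E i. ennreal (norm (f x - k i) powr (s * q)) * ennreal (w x) \<partial>lebesgue) \<le>
          ennreal D * oscillation_modular s q w f (2 * \<rho>)" .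
      have "Lp_modular (s * q) w (\<lambda>x. f x - step_function E m k x) \<le>
          (\<integral>\<^sup>+x. (\<Sum>i<m. ennreal (norm (f x - k i) powr (s * q)) * ennreal (w x) * indicator (E i) x) +
          ennreal (norm (indicator {x. norm x > A} x *\<^sub>R f x) powr (s * q)) * ennreal (w x) \<partial>lebesgue)"
        unfolding Lp_modular_def by (rule nn_integral_mono[OF pt])
      also have "\<dots> = (\<integral>\<^sup>+x. (\<Sum>i<m. ennreal (norm (f x - k i) powr (s * q)) * ennreal (w x) * indicator (E i) x) \<partial>lebesgue) +
          Lp_modular (s * q) w (\<lambda>x. indicator {x. norm x > A} x *\<^sub>R f x)"
        unfolding Lp_modular_def by (rule nn_integral_add) measurable
      also have "(\<integral>\<^sup>+x. (\<Sum>i<m. ennreal (norm (f x - k i) powr (s * q)) * ennreal (w x) * indicator (E i) x) \<partial>lebesgue) =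
          (\<Sum>i<m. \<integral>\<^sup>+x\<in>E i. ennreal (norm (f x - k i) powr (s * q)) * ennreal (w x) \<partial>lebesgue)"
        by (rule nn_integral_sum) measurable
      also have "\<dots> + Lp_modular (s * q) w (\<lambda>x. indicator {x. norm x > A} x *\<^sub>R f x) \<le>
          ennreal D * oscillation_modular s q w f (2 * \<rho>) +
          Lp_modular (s * q) w (\<lambda>x. indicator {x. norm x > A} x *\<^sub>R f x)"
        by (rule add_right_mono[OF cells])
      finally show ?thesis
        using k by (intro exI[of _ k]) auto
    qed
    then show "\<exists>E m. (\<forall>i. E i \<in> sets lebesgue) \<and> disjoint_family E \<and>
      (\<forall>i. (\<integral>\<^sup>+x\<in>E i. ennreal (w x) \<partial>lebesgue) < top) \<and>
      (\<forall>f::real ^ 'n \<Rightarrow> 'k\<in>borel_measurable lebesgue.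
        \<exists>k. (\<forall>i<m. (\<integral>\<^sup>+x\<in>E i. ennreal (w x) \<partial>lebesgue) = 0 \<longrightarrow> k i = 0) \<and>
        Lp_modular (s * q) w (\<lambda>x. f x - step_function E m k x) \<le>
        ennreal D * oscillation_modular s q w f (2 * \<rho>) +
        Lp_modular (s * q) w (\<lambda>x. indicator {x. norm x > A} x *\<^sub>R f x))"
      using Es Ed Ew by (intro exI[of _ E] exI[of _ m]) blast
  qed
qed

section \<open>Total boundedness in weighted Lebesgue spaces\<close>

definition Lp_totally_bounded ::
  "real \<Rightarrow> (real ^ 'n \<Rightarrow> real) \<Rightarrow> (real ^ 'n \<Rightarrow> 'k::{real_normed_field,euclidean_space}) set \<Rightarrow> bool" where
  "Lp_totally_bounded p w G \<longleftrightarrow> (\<forall>e>0. \<exists>F. finite F \<and> F \<subseteq> Lp_space p w \<and>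
    (\<forall>f\<in>G. \<exists>g\<in>F. Lp_modular p w (\<lambda>x. f x - g x) < ennreal e))"

lemma tail_indicator_measurable:
  "(\<lambda>x::real^'n. indicator {x. norm x > A} x :: real) \<in> borel_measurable lebesgue"
  by (rule borel_measurable_indicator) (simp add: open_Collect_less continuous_on_norm)

lemma Lp_totally_bounded_bounded:
  assumes p: "0 < p" and w: "w \<in> borel_measurable lebesgue" and G: "G \<subseteq> Lp_space p w"
    and tb: "Lp_totally_bounded p w G"
  shows "\<exists>M\<ge>0. \<forall>f\<in>G. Lp_modular p w f \<le> ennreal M"
proof -
  obtain F where F: "finite F" "F \<subseteq> Lp_space p w" "\<And>f. f \<in> G \<Longrightarrow> \<exists>g\<in>F. Lp_modular p w (\<lambda>x. f x - g x) < ennreal 1"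
    using tb zero_less_one unfolding Lp_totally_bounded_def by meson
  define M where "M = ennreal (2 powr p) * (1 + (\<Sum>g\<in>F. Lp_modular p w g))"
  have "(\<Sum>g\<in>F. Lp_modular p w g) < top"
    using F(1,2) by (auto simp: Lp_space_iff)
  then have M: "M < top" by (simp add: M_def ennreal_mult_less_top)
  have "Lp_modular p w f \<le> M" if f: "f \<in> G" for f
  proof -
    obtain g where g: "g \<in> F" "Lp_modular p w (\<lambda>x. f x - g x) < ennreal 1" using F(3)[OF f] by blast
    have "Lp_modular p w f \<le> ennreal (2 powr p) * (Lp_modular p w (\<lambda>x. f x - g x) + Lp_modular p w g)"
      using p w f G F(2) g(1) by (intro Lp_modular_le_diff) (auto dest: Lp_space_measurable)
    also have "\<dots> \<le> M"
      unfolding M_def using g F(1) by (intro mult_left_mono add_mono member_le_sum) auto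
    finally show ?thesis .
  qed
  then show ?thesis
    using M by (intro exI[of _ "enn2real M"]) auto
qed

text \<open>
  A functional that is controlled by the modular up to a perturbation and that is small for each single
  function is small uniformly on a totally bounded set; this serves for the tails and for the oscillations.
\<close>

lemma Lp_totally_bounded_uniformly_small:
  fixes H :: "(real ^ 'n \<Rightarrow> 'k::{real_normed_field,euclidean_space}) \<Rightarrow> real \<Rightarrow> ennreal"
  assumes tb: "Lp_totally_bounded p w G" and G: "G \<subseteq> Lp_space p w" and C: "0 < C"
    and perturb: "\<forall>\<^sub>F t in net. \<forall>f\<in>Lp_space p w. \<forall>g\<in>Lp_space p w. 
      H f t \<le> ennreal C * (Lp_modular p w (\<lambda>x. f x - g x) + H g t)"
    and small: "\<And>g e. g \<in> Lp_space p w \<Longrightarrow> 0 < e \<Longrightarrow> \<forall>\<^sub>F t in net. H g t < ennreal e"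
    and e: "0 < e"
  shows "\<forall>\<^sub>F t in net. \<forall>f\<in>G. H f t < ennreal e"
proof -
  define e' where "e' = e / (2 * C)"
  have e': "0 < e'" using e C by (simp add: e'_def)
  obtain F where F: "finite F" "F \<subseteq> Lp_space p w" "\<And>f. f \<in> G \<Longrightarrow> \<exists>g\<in>F. Lp_modular p w (\<lambda>x. f x - g x) < ennreal e'"
    using tb e' unfolding Lp_totally_bounded_def by meson
  have "\<forall>\<^sub>F t in net. \<forall>g\<in>F. H g t < ennreal e'"
    using F(1,2) small[OF _ e'] by (intro eventually_ball_finite) auto
  with perturb show ?thesis
  proof eventually_elim
    fix t
    assume P: "\<forall>f\<in>Lp_space p w. \<forall>g\<in>Lp_space p w. H f t \<le> ennreal C * (Lp_modular p w (\<lambda>x. f x - g x) + H g t)"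
      and t: "\<forall>g\<in>F. H g t < ennreal e'"
    show "\<forall>f\<in>G. H f t < ennreal e"
    proof
      fix f assume f: "f \<in> G"
      obtain g where g: "g \<in> F" "Lp_modular p w (\<lambda>x. f x - g x) < ennreal e'" using F(3)[OF f] by blast
      have "H f t \<le> ennreal C * (Lp_modular p w (\<lambda>x. f x - g x) + H g t)"
        using P f g(1) G F(2) by blast
      also have "\<dots> < ennreal C * (ennreal e' + ennreal e')"
        using g t C by (intro ennreal_mult_strict_left_mono add_strict_mono) auto
      also have "\<dots> = ennreal e"
        using e C by (simp add: e'_def flip: ennreal_plus ennreal_mult)
      finally show "H f t < ennreal e" .
    qed
  qed
qed

lemma Lp_totally_bounded_tails:
  fixes w :: "real ^ 'n \<Rightarrow> real" and G :: "(real ^ 'n \<Rightarrow> 'k::{real_normed_field,euclidean_space}) set"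
  assumes p: "0 < p" and w: "w \<in> borel_measurable lebesgue" and G: "G \<subseteq> Lp_space p w"
    and tb: "Lp_totally_bounded p w G" and e: "0 < e"
  shows "\<forall>\<^sub>F A in at_top. \<forall>f\<in>G. Lp_modular p w (\<lambda>x. indicator {x. norm x > A} x *\<^sub>R f x) < ennreal e"
proof (rule Lp_totally_bounded_uniformly_small[OF tb G _ _ _ e])
  note [measurable] = tail_indicator_measurable
  show "0 < 2 powr p" by simp
  have "Lp_modular p w (\<lambda>x. indicator {x. norm x > A} x *\<^sub>R f x) \<le>
      ennreal (2 powr p) * (Lp_modular p w (\<lambda>x. f x - g x) + Lp_modular p w (\<lambda>x. indicator {x. norm x > A} x *\<^sub>R g x))"
    if "f \<in> Lp_space p w" "g \<in> Lp_space p w" for A and f g :: "real ^ 'n \<Rightarrow> 'k"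
  proof -
    have [measurable]: "f \<in> borel_measurable lebesgue" "g \<in> borel_measurable lebesgue" "w \<in> borel_measurable lebesgue"
      using that w by (auto dest: Lp_space_measurable)
    have "Lp_modular p w (\<lambda>x. indicator {x. norm x > A} x *\<^sub>R f x) \<le> ennreal (2 powr p) *
        (Lp_modular p w (\<lambda>x. indicator {x. norm x > A} x *\<^sub>R f x - indicator {x. norm x > A} x *\<^sub>R g x) +
         Lp_modular p w (\<lambda>x. indicator {x. norm x > A} x *\<^sub>R g x))"
      using p by (intro Lp_modular_le_diff) auto
    also have "\<dots> \<le> ennreal (2 powr p) * (Lp_modular p w (\<lambda>x. f x - g x) +
         Lp_modular p w (\<lambda>x. indicator {x. norm x > A} x *\<^sub>R g x))"
    proof (intro mult_left_mono add_right_mono)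
      show "Lp_modular p w (\<lambda>x. indicator {x. norm x > A} x *\<^sub>R f x - indicator {x. norm x > A} x *\<^sub>R g x) \<le>
          Lp_modular p w (\<lambda>x. f x - g x)"
        unfolding Lp_modular_def by (intro nn_integral_mono mult_right_mono) (auto simp: indicator_def)
    qed simp
    finally show ?thesis .
  qed
  then show "\<forall>\<^sub>F A in at_top. \<forall>f\<in>Lp_space p w. \<forall>g::real ^ 'n \<Rightarrow> 'k\<in>Lp_space p w.
      Lp_modular p w (\<lambda>x. indicator {x. norm x > A} x *\<^sub>R f x) \<le> ennreal (2 powr p) *
      (Lp_modular p w (\<lambda>x. f x - g x) + Lp_modular p w (\<lambda>x. indicator {x. norm x > A} x *\<^sub>R g x))"
    by (intro always_eventually) blast
  show "\<forall>\<^sub>F A in at_top. Lp_modular p w (\<lambda>x. indicator {x. norm x > A} x *\<^sub>R g x) < ennreal \<epsilon>"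
    if "g \<in> Lp_space p w" "0 < \<epsilon>" for g :: "real ^ 'n \<Rightarrow> 'k" and \<epsilon>
    using Lp_modular_tail_small[OF p w that] unfolding eventually_at_top_linorder .
qed

lemma Lp_totally_bounded_oscillation:
  fixes w :: "real ^ 'n \<Rightarrow> real" and G :: "(real ^ 'n \<Rightarrow> 'k::{real_normed_field,euclidean_space}) set"
  assumes s: "0 < s" and q: "1 < q" and w: "w \<in> A_class q" and G: "G \<subseteq> Lp_space (s * q) w"
    and tb: "Lp_totally_bounded (s * q) w G" and e: "0 < e"
  shows "\<forall>\<^sub>F r in at_right 0. \<forall>f\<in>G. oscillation_modular s q w f r < ennreal e"
proof -
  obtain C :: real where C: "0 < C" "\<And>f g :: real ^ 'n \<Rightarrow> 'k. \<And>r. f \<in> borel_measurable lebesgue \<Longrightarrow>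
      g \<in> borel_measurable lebesgue \<Longrightarrow> 0 < r \<Longrightarrow> oscillation_modular s q w f r \<le>
        ennreal C * (Lp_modular (s * q) w (\<lambda>x. f x - g x) + oscillation_modular s q w g r)"
    using oscillation_modular_perturb[OF s q w, where 'k = 'k] by meson
  show ?thesis
  proof (rule Lp_totally_bounded_uniformly_small[OF tb G C(1) _ _ e])
    have "\<forall>\<^sub>F r::real in at_right 0. 0 < r"
      by (rule eventually_at_right_less)
    then show "\<forall>\<^sub>F r in at_right 0. \<forall>f\<in>Lp_space (s * q) w. \<forall>g::real ^ 'n \<Rightarrow> 'k\<in>Lp_space (s * q) w.
        oscillation_modular s q w f r \<le>
        ennreal C * (Lp_modular (s * q) w (\<lambda>x. f x - g x) + oscillation_modular s q w g r)"
      by eventually_elim (auto intro!: C(2) dest: Lp_space_measurable)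
    show "\<forall>\<^sub>F r in at_right 0. oscillation_modular s q w g r < ennreal \<epsilon>"
      if "g \<in> Lp_space (s * q) w" "0 < \<epsilon>" for g :: "real ^ 'n \<Rightarrow> 'k" and \<epsilon>
      using oscillation_modular_small[OF s q w that] unfolding eventually_at_right_field by blast
  qed
qed

text \<open>
  Step functions with values taken from the function approximate it up to \<open>e'\<close>. Since their modulars are then bounded, a
  finite net of them at distance \<open>e'\<close> is a net for the whole set at distance \<open>2\<^sup>p (e' + e') = e\<close>.
\<close>

lemma Lp_totally_bounded_if:
  fixes w :: "real ^ 'n \<Rightarrow> real" and G :: "(real ^ 'n \<Rightarrow> 'k::{real_normed_field,euclidean_space}) set"
  assumes s: "0 < s" and q: "1 < q" and w: "is_weight w"
    and loc: "\<And>z \<rho>. (\<integral>\<^sup>+x\<in>ball z \<rho>. ennreal (w x) \<partial>lebesgue) < top"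
    and G: "G \<subseteq> Lp_space (s * q) w" and M: "0 \<le> M" "\<And>f. f \<in> G \<Longrightarrow> Lp_modular (s * q) w f \<le> ennreal M"
    and tails: "\<And>e. 0 < e \<Longrightarrow>
      \<forall>\<^sub>F A in at_top. \<forall>f\<in>G. Lp_modular (s * q) w (\<lambda>x. indicator {x. norm x > A} x *\<^sub>R f x) < ennreal e"
    and osc: "\<And>e. 0 < e \<Longrightarrow> \<forall>\<^sub>F r in at_right 0. \<forall>f\<in>G. oscillation_modular s q w f r < ennreal e"
  shows "Lp_totally_bounded (s * q) w G"
  unfolding Lp_totally_bounded_def
proof (intro allI impI)
  fix e :: real assume e: "0 < e"
  have wm [measurable]: "w \<in> borel_measurable lebesgue" using w by (simp add: is_weight_def)
  define p where "p = s * q"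
  have p: "0 < p" using s q by (simp add: p_def)
  obtain D :: real where D: "0 < D" "\<And>\<rho> A. 0 < \<rho> \<Longrightarrow> \<exists>E m. (\<forall>i. E i \<in> sets lebesgue) \<and> disjoint_family E \<and>
    (\<forall>i. (\<integral>\<^sup>+x\<in>E i. ennreal (w x) \<partial>lebesgue) < top) \<and>
    (\<forall>f::real ^ 'n \<Rightarrow> 'k\<in>borel_measurable lebesgue.
      \<exists>k. (\<forall>i<m. (\<integral>\<^sup>+x\<in>E i. ennreal (w x) \<partial>lebesgue) = 0 \<longrightarrow> k i = 0) \<and>
        Lp_modular p w (\<lambda>x. f x - step_function E m k x) \<le>
        ennreal D * oscillation_modular s q w f (2 * \<rho>) +
        Lp_modular p w (\<lambda>x. indicator {x. norm x > A} x *\<^sub>R f x))"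
    using step_function_approximation[OF s q w loc, where 'k = 'k] unfolding p_def by blast
  define e' where "e' = e / (2 * 2 powr p)"
  have e': "0 < e'" using e by (simp add: e'_def)
  obtain A where A: "\<And>f. f \<in> G \<Longrightarrow> Lp_modular p w (\<lambda>x. indicator {x. norm x > A} x *\<^sub>R f x) < ennreal (e' / 2)"
    using eventually_happens'[OF trivial_limit_at_top_linorder tails[of "e' / 2"]] e'
    unfolding p_def by auto
  obtain b where b: "0 < b" "\<And>r f. 0 < r \<Longrightarrow> r < b \<Longrightarrow> f \<in> G \<Longrightarrow> oscillation_modular s q w f r < ennreal (e' / (2 * D))"
    using osc[of "e' / (2 * D)"] e' D(1) unfolding eventually_at_right_field by auto
  define \<rho> where "\<rho> = b / 4"
  have \<rho>: "0 < \<rho>" "2 * \<rho> < b" using b(1) by (auto simp: \<rho>_def)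
  obtain E m where Es: "\<And>i. E i \<in> sets lebesgue" and Ed: "disjoint_family E"
    and Ew: "\<And>i. (\<integral>\<^sup>+x\<in>E i. ennreal (w x) \<partial>lebesgue) < top"
    and approx: "\<And>f::real ^ 'n \<Rightarrow> 'k. f \<in> borel_measurable lebesgue \<Longrightarrow>
      \<exists>k. (\<forall>i<m. (\<integral>\<^sup>+x\<in>E i. ennreal (w x) \<partial>lebesgue) = 0 \<longrightarrow> k i = 0) \<and>
        Lp_modular p w (\<lambda>x. f x - step_function E m k x) \<le>
        ennreal D * oscillation_modular s q w f (2 * \<rho>) +
        Lp_modular p w (\<lambda>x. indicator {x. norm x > A} x *\<^sub>R f x)"
    using D(2)[OF \<rho>(1), of A] by blast
  note step_m = step_function_measurable[of E lebesgue, OF Es]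
  define M' where "M' = 2 powr p * (e' + M)"
  have M': "0 \<le> M'" using e' M(1) by (simp add: M'_def)
  obtain F :: "(real ^ 'n \<Rightarrow> 'k) set" where F: "finite F" "F \<subseteq> Lp_space p w"
    "\<And>k. (\<forall>i<m. (\<integral>\<^sup>+x\<in>E i. ennreal (w x) \<partial>lebesgue) = 0 \<longrightarrow> k i = 0) \<Longrightarrow>
      Lp_modular p w (step_function E m k) \<le> ennreal M' \<Longrightarrow>
      \<exists>g\<in>F. Lp_modular p w (\<lambda>x. step_function E m k x - g x) < ennreal e'"
    using bounded_step_functions_totally_bounded[OF p wm Es Ed Ew M' e', of m, where 'k = 'k] by blast
  have "\<exists>g\<in>F. Lp_modular p w (\<lambda>x. f x - g x) < ennreal e" if f: "f \<in> G" for f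
  proof -
    have fm [measurable]: "f \<in> borel_measurable lebesgue" using f G Lp_space_measurable by blast
    obtain k where k: "\<forall>i<m. (\<integral>\<^sup>+x\<in>E i. ennreal (w x) \<partial>lebesgue) = 0 \<longrightarrow> k i = 0"
      "Lp_modular p w (\<lambda>x. f x - step_function E m k x) \<le>
        ennreal D * oscillation_modular s q w f (2 * \<rho>) +
        Lp_modular p w (\<lambda>x. indicator {x. norm x > A} x *\<^sub>R f x)"
      using approx[OF fm] by blast
    note [measurable] = step_m[of m k]
    have "ennreal D * oscillation_modular s q w f (2 * \<rho>) \<le> ennreal D * ennreal (e' / (2 * D))"
      using b(2)[of "2 * \<rho>" f] \<rho> f by (intro mult_left_mono) auto
    also have "\<dots> = ennreal (e' / 2)"
      using D(1) e' by (simp flip: ennreal_mult)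
    finally have small: "ennreal D * oscillation_modular s q w f (2 * \<rho>) \<le> ennreal (e' / 2)" .
    note k(2)
    also note add_right_mono[OF small]
    also have "ennreal (e' / 2) + Lp_modular p w (\<lambda>x. indicator {x. norm x > A} x *\<^sub>R f x) <
        ennreal (e' / 2) + ennreal (e' / 2)"
      using A[OF f] by (simp add: ennreal_add_left_cancel_less)
    finally have near: "Lp_modular p w (\<lambda>x. f x - step_function E m k x) < ennreal e'"
      using e' by (simp flip: ennreal_plus)
    have "Lp_modular p w (step_function E m k) \<le> ennreal (2 powr p) *
        (Lp_modular p w (\<lambda>x. step_function E m k x - f x) + Lp_modular p w f)"
      using p by (intro Lp_modular_le_diff) auto
    also have "\<dots> \<le> ennreal (2 powr p) * (ennreal e' + ennreal M)"
      using near M(2)[OF f] by (intro mult_left_mono add_mono) (auto simp: Lp_modular_minus_commute[of _ _ _ f] p_def)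
    also have "\<dots> = ennreal M'"
      using e' M(1) by (simp add: M'_def flip: ennreal_plus ennreal_mult)
    finally obtain g where g: "g \<in> F" "Lp_modular p w (\<lambda>x. step_function E m k x - g x) < ennreal e'"
      using F(3)[OF k(1)] by blast
    have "Lp_modular p w (\<lambda>x. f x - g x) \<le> ennreal (2 powr p) *
        (Lp_modular p w (\<lambda>x. f x - step_function E m k x) + Lp_modular p w (\<lambda>x. step_function E m k x - g x))"
      using p g(1) F(2) by (intro Lp_modular_triangle) (auto dest: Lp_space_measurable)
    also have "\<dots> < ennreal (2 powr p) * (ennreal e' + ennreal e')"
      using near g(2) by (intro ennreal_mult_strict_left_mono add_strict_mono) auto
    also have "\<dots> = ennreal e"
      using e by (simp add: e'_def flip: ennreal_plus ennreal_mult)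
    finally show ?thesis using g(1) by blast
  qed
  then show "\<exists>F. finite F \<and> F \<subseteq> Lp_space (s * q) w \<and>
      (\<forall>f\<in>G. \<exists>g\<in>F. Lp_modular (s * q) w (\<lambda>x. f x - g x) < ennreal e)"
    using F(1,2) unfolding p_def by blast
qed

section \<open>The compactness criterion\<close>

text \<open>
  The exponent \<open>1 / p\<close> is used for the tails, where the quasi-norm occurs, and exponent \<open>1\<close> for the oscillations.
\<close>

lemma SUP_ennpowr_tendsto_0_iff:
  fixes H :: "'a \<Rightarrow> 'b \<Rightarrow> ennreal"
  assumes p: "0 < p"
  shows "((\<lambda>t. SUP f\<in>G. ennpowr (H f t) (1 / p)) \<longlongrightarrow> 0) net \<longleftrightarrow>
    (\<forall>e>0. \<forall>\<^sub>F t in net. \<forall>f\<in>G. H f t < ennreal e)"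
proof (intro iffI allI impI)
  fix e :: real assume lim: "((\<lambda>t. SUP f\<in>G. ennpowr (H f t) (1 / p)) \<longlongrightarrow> 0) net" and e: "0 < e"
  have "\<forall>\<^sub>F t in net. (SUP f\<in>G. ennpowr (H f t) (1 / p)) < ennreal (e powr (1 / p))"
    using e by (intro order_tendstoD(2)[OF lim]) simp
  then show "\<forall>\<^sub>F t in net. \<forall>f\<in>G. H f t < ennreal e"
  proof eventually_elim
    case (elim t)
    show ?case
    proof
      fix f assume "f \<in> G"
      then have "ennpowr (H f t) (1 / p) < ennreal (e powr (1 / p))"
        using elim by (meson SUP_upper le_less_trans)
      then show "H f t < ennreal e"
        using p e by (simp add: ennpowr_less_iff powr_powr)
    qed
  qed
next
  assume H: "\<forall>e>0. \<forall>\<^sub>F t in net. \<forall>f\<in>G. H f t < ennreal e"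
  show "((\<lambda>t. SUP f\<in>G. ennpowr (H f t) (1 / p)) \<longlongrightarrow> 0) net"
  proof (rule order_tendstoI)
    fix a :: ennreal assume "0 < a"
    then obtain e where e: "0 < e" "ennreal e < a"
      by (metis dense ennreal_cases ennreal_less_zero_iff less_top_ennreal top.extremum_strict)
    have "\<forall>\<^sub>F t in net. \<forall>f\<in>G. H f t < ennreal (e powr p)" using H e(1) by simp
    then show "\<forall>\<^sub>F t in net. (SUP f\<in>G. ennpowr (H f t) (1 / p)) < a"
    proof eventually_elim
      case (elim t)
      then have "ennpowr (H f t) (1 / p) < ennreal e" if "f \<in> G" for f
        using that p e(1) by (simp add: ennpowr_less_iff)
      then have "(SUP f\<in>G. ennpowr (H f t) (1 / p)) \<le> ennreal e"
        by (intro SUP_least less_imp_le)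
      then show ?case using e(2) by simp
    qed
  qed simp
qed

lemma SUP_Lp_norm_finite_iff:
  assumes p: "0 < p"
  shows "(SUP f\<in>G. Lp_norm p w f) < \<infinity> \<longleftrightarrow> (\<exists>M\<ge>0. \<forall>f\<in>G. Lp_modular p w f \<le> ennreal M)"
proof
  assume "(SUP f\<in>G. Lp_norm p w f) < \<infinity>"
  then obtain c where c: "0 \<le> c" "(SUP f\<in>G. Lp_norm p w f) = ennreal c"
    by (cases "SUP f\<in>G. Lp_norm p w f") auto
  have "Lp_modular p w f \<le> ennreal (c powr p)" if "f \<in> G" for f
  proof -
    have "Lp_norm p w f \<le> ennreal c" using c(2) that by (metis SUP_upper)
    then have "ennpowr (Lp_norm p w f) p \<le> ennpowr (ennreal c) p"
      using p by (intro ennpowr_mono) auto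
    then show ?thesis
      using p c(1) by (simp add: Lp_norm_eq_modular ennpowr_ennpowr ennpowr_ennreal)
  qed
  then show "\<exists>M\<ge>0. \<forall>f\<in>G. Lp_modular p w f \<le> ennreal M" by (intro exI[of _ "c powr p"]) auto
next
  assume "\<exists>M\<ge>0. \<forall>f\<in>G. Lp_modular p w f \<le> ennreal M"
  then obtain M where M: "0 \<le> M" "\<And>f. f \<in> G \<Longrightarrow> Lp_modular p w f \<le> ennreal M" by blast
  have "(SUP f\<in>G. Lp_norm p w f) \<le> ennpowr (ennreal M) (1 / p)"
    unfolding Lp_norm_eq_modular using p M(2) by (intro SUP_least ennpowr_mono) auto
  also have "\<dots> < \<infinity>" using M(1) by (simp add: ennpowr_ennreal)
  finally show "(SUP f\<in>G. Lp_norm p w f) < \<infinity>" .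
qed

theorem theorem2p10:
  fixes p p\<^sub>0 :: real
    and w :: "real ^ 'n \<Rightarrow> real"
    and G :: "(real ^ 'n \<Rightarrow> 'k::{real_normed_field,euclidean_space}) set"
  assumes "0 < p" and "1 < p\<^sub>0" and "w \<in> A_class p\<^sub>0" and "G \<subseteq> Lp_space p w"
  shows "compactin (Lp_topology p w) (Lp_topology p w closure_of G) \<longleftrightarrow>
      (SUP f\<in>G. Lp_norm p w f) < \<infinity> \<and>
      ((\<lambda>A::real. SUP f\<in>G. Lp_norm p w (\<lambda>x. indicator {x. norm x > A} x *\<^sub>R f x)) \<longlongrightarrow> 0) at_top \<and>
      ((\<lambda>r::real. SUP f\<in>G. \<integral>\<^sup>+x.
          ennpowr (avg (ball 0 r) (\<lambda>y. ennreal (norm (f x - f (x + y)) powr (p / p\<^sub>0)))) p\<^sub>0 * ennreal (w x)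
        \<partial>lebesgue) \<longlongrightarrow> 0) (at_right 0)"
proof -
  define s where "s = p / p\<^sub>0"
  have s: "0 < s" "s * p\<^sub>0 = p" using assms(1,2) by (auto simp: s_def)
  have w: "is_weight w" using assms(3) by (rule A_class_is_weight)
  then have wm: "w \<in> borel_measurable lebesgue" by (simp add: is_weight_def)
  interpret Q: quasi_pseudometric "Lp_space p w"
    "\<lambda>f g :: real ^ 'n \<Rightarrow> 'k. Lp_modular p w (\<lambda>x. f x - g x)" "2 powr p" "Lp_topology p w"
    by (rule quasi_pseudometric_Lp[OF assms(1) w])
  have "compactin (Lp_topology p w) (Lp_topology p w closure_of G) \<longleftrightarrow> Lp_totally_bounded p w G"
    using Q.compactin_closure_iff_totally_bounded[OF assms(4)]
    by (simp add: Q.totally_bounded_def Lp_totally_bounded_def)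
  also have "\<dots> \<longleftrightarrow> (\<exists>M\<ge>0. \<forall>f\<in>G. Lp_modular p w f \<le> ennreal M) \<and>
      (\<forall>e>0. \<forall>\<^sub>F A in at_top. \<forall>f\<in>G. Lp_modular p w (\<lambda>x. indicator {x. norm x > A} x *\<^sub>R f x) < ennreal e) \<and>
      (\<forall>e>0. \<forall>\<^sub>F r in at_right 0. \<forall>f\<in>G. oscillation_modular s p\<^sub>0 w f r < ennreal e)"
    (is "_ \<longleftrightarrow> ?bounded \<and> ?tails \<and> ?osc")
  proof
    assume tb: "Lp_totally_bounded p w G"
    show "?bounded \<and> ?tails \<and> ?osc"
      using Lp_totally_bounded_bounded[OF assms(1) wm assms(4) tb]
        Lp_totally_bounded_tails[OF assms(1) wm assms(4) tb]
        Lp_totally_bounded_oscillation[OF s(1) assms(2,3), of G] assms(4) tb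
      unfolding s(2) by blast
  next
    assume "?bounded \<and> ?tails \<and> ?osc"
    then show "Lp_totally_bounded p w G"
      using Lp_totally_bounded_if[OF s(1) assms(2) w A_class_locally_integrable[OF assms(3,2)], of G] assms(4)
      unfolding s(2) by blast
  qed
  also have "?bounded \<longleftrightarrow> (SUP f\<in>G. Lp_norm p w f) < \<infinity>"
    by (rule SUP_Lp_norm_finite_iff[OF assms(1), symmetric])
  also have "?tails \<longleftrightarrow>
      ((\<lambda>A::real. SUP f\<in>G. Lp_norm p w (\<lambda>x. indicator {x. norm x > A} x *\<^sub>R f x)) \<longlongrightarrow> 0) at_top"
    unfolding Lp_norm_eq_modular by (rule SUP_ennpowr_tendsto_0_iff[OF assms(1), symmetric])
  also have "?osc \<longleftrightarrow> ((\<lambda>r. SUP f\<in>G. oscillation_modular s p\<^sub>0 w f r) \<longlongrightarrow> 0) (at_right 0)"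
    using SUP_ennpowr_tendsto_0_iff[of 1 "\<lambda>f. oscillation_modular s p\<^sub>0 w f" G "at_right 0"] by simp
  also have "(\<lambda>r. SUP f\<in>G. oscillation_modular s p\<^sub>0 w f r) = (\<lambda>r::real. SUP f\<in>G. \<integral>\<^sup>+x.
      ennpowr (avg (ball 0 r) (\<lambda>y. ennreal (norm (f x - f (x + y)) powr (p / p\<^sub>0)))) p\<^sub>0 * ennreal (w x) \<partial>lebesgue)"
    unfolding oscillation_modular_def s_def
    by (intro ext SUP_cong refl) (simp add: avg_eq_oscillation[OF Lp_space_measurable[OF subsetD[OF assms(4)]]])
  finally show ?thesis .
qed

end
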